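(* Up to isomorphism there are exactly twenty-eight graphs, with or without loops (and without multiple edges), on one, two or three vertices, namely the graphs $H_1,\ldots,H_{28}$ listed in the context. For each such $H$, each $n\ge 2$ and each $T_n\in\mathcal{T}_n$, $\hom(P_n,H)\le\hom(T_n,H)$. Moreover, for each $n\ge 2$, the trees $T_n\in\mathcal{T}_n$ minimizing $\hom(T_n,H)$ over $\mathcal{T}_n$ are as follows. (i) All trees in $\mathcal{T}_n$ are minimizers, with $\hom(T_n,H)$ equal for every $T_n\in\mathcal{T}_n$ to: $0$ for $H_1,H_3,H_9$; $1$ for $H_2,H_4,H_{10}$; $2$ for $H_5,H_6,H_{11},H_{13}$; $3$ for $H_{12},H_{14}$; $2^n$ for $H_8,H_{17}$; $2^n+1$ for $H_{18}$; $3\cdot 2^{n-1}$ for $H_{23},H_{25}$; $3^n$ for $H_{28}$. (ii) For $H_{19}$, the minimizers are precisely the trees in $\mathcal{T}_n$ that have a balanced bipartition. (iii) For $H_7,H_{15},H_{16},H_{20},H_{21},H_{22},H_{24},H_{26},H_{27}$, the path $P_n$ is the unique minimizer.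
   Context: For a graph $H$ (no multiple edges, possibly with loops) and a simple loopless graph $G$, an $H$-coloring of $G$ is a map $f:V(G)\to V(H)$ such that $f(u)\sim_H f(v)$ whenever $u\sim_G v$; $\hom(G,H)$ denotes the number of $H$-colorings of $G$. $\mathcal{T}_n$ is the set of all trees on $n$ vertices (up to isomorphism) and $P_n\in\mathcal{T}_n$ is the path on $n$ vertices. A bipartition $V(G)=X\cup Y$ of a bipartite graph is balanced if $|X|=|Y|$ when $|V(G)|$ is even and $\bigl||X|-|Y|\bigr|=1$ when $|V(G)|$ is odd. The graphs, given by edge sets, where $ij$ denotes an edge between $i$ and $j$ and $ii$ denotes a loop at $i$: On vertex set $\{1\}$: $H_1$: no edges; $H_2$: $11$. On vertex set $\{1,2\}$: $H_3$: no edges; $H_4$: $22$; $H_5$: $11,22$; $H_6$: $12$; $H_7$: $12,22$; $H_8$: $12,11,22$. On vertex set $\{1,2,3\}$: $H_9$: no edges; $H_{10}$: $22$; $H_{11}$: $11,33$; $H_{12}$: $11,22,33$; $H_{13}$: $12$; $H_{14}$: $12,33$; $H_{15}$: $12,11$; $H_{16}$: $12,11,33$; $H_{17}$: $12,11,22$; $H_{18}$: $12,11,22,33$; $H_{19}$: $12,23$; $H_{20}$: $12,23,11$; $H_{21}$: $12,23,22$; $H_{22}$: $12,23,22,33$; $H_{23}$: $12,23,11,33$; $H_{24}$: $12,23,11,22,33$; $H_{25}$: $12,23,13$; $H_{26}$: $12,23,13,11$; $H_{27}$: $12,23,13,11,22$; $H_{28}$: $12,23,13,11,22,33$. *)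

theory Defs
  imports "HOL-Library.FuncSet"
begin

text \<open>
  An edge between \<open>u\<close> and \<open>v\<close> is the set \<open>{u, v}\<close>; thus a loop at \<open>u\<close> is the singleton
  \<open>{u, u} = {u}\<close>, and there are no multiple edges.
\<close>

record 'a ugraph =
  verts :: "'a set"
  edges :: "'a set set"

definition adj :: "'a ugraph \<Rightarrow> 'a \<Rightarrow> 'a \<Rightarrow> bool" where
  "adj G u v \<longleftrightarrow> {u, v} \<in> edges G"

definition loop_graph :: "'a ugraph \<Rightarrow> bool" where
  "loop_graph G \<longleftrightarrow> finite (verts G) \<and>
     (\<forall>e\<in>edges G. e \<subseteq> verts G \<and> (card e = 1 \<or> card e = 2))"

definition simple_graph :: "'a ugraph \<Rightarrow> bool" where
  "simple_graph G \<longleftrightarrow> loop_graph G \<and> (\<forall>v\<in>verts G. \<not> adj G v v)"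

definition graph_iso :: "'a ugraph \<Rightarrow> 'b ugraph \<Rightarrow> bool" where
  "graph_iso G H \<longleftrightarrow>
     (\<exists>\<phi>. bij_betw \<phi> (verts G) (verts H) \<and>
          (\<forall>u\<in>verts G. \<forall>v\<in>verts G. adj G u v \<longleftrightarrow> adj H (\<phi> u) (\<phi> v)))"

text \<open>
  Colorings are taken extensional (\<open>undefined\<close> off \<open>verts G\<close>), so that each map
  \<open>V(G) \<rightarrow> V(H)\<close> is counted exactly once.
\<close>

definition colorings :: "'a ugraph \<Rightarrow> 'b ugraph \<Rightarrow> ('a \<Rightarrow> 'b) set" where
  "colorings G H = {f \<in> verts G \<rightarrow>\<^sub>E verts H.
     \<forall>u\<in>verts G. \<forall>v\<in>verts G. adj G u v \<longrightarrow> adj H (f u) (f v)}"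

definition hom :: "'a ugraph \<Rightarrow> 'b ugraph \<Rightarrow> nat" where
  "hom G H = card (colorings G H)"

definition connected_graph :: "'a ugraph \<Rightarrow> bool" where
  "connected_graph G \<longleftrightarrow> verts G \<noteq> {} \<and> (\<forall>u\<in>verts G. \<forall>v\<in>verts G. (adj G)\<^sup>*\<^sup>* u v)"

definition is_cycle :: "'a ugraph \<Rightarrow> 'a list \<Rightarrow> bool" where
  "is_cycle G xs \<longleftrightarrow> 3 \<le> length xs \<and> distinct xs \<and>
     (\<forall>i<length xs. adj G (xs ! i) (xs ! (Suc i mod length xs)))"

definition tree :: "'a ugraph \<Rightarrow> bool" where
  "tree G \<longleftrightarrow> simple_graph G \<and> connected_graph G \<and> (\<nexists>xs. is_cycle G xs)"

definition trees :: "nat \<Rightarrow> 'a ugraph set" where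
  "trees n = {T. tree T \<and> card (verts T) = n}"

definition path_graph :: "nat \<Rightarrow> nat ugraph" where
  "path_graph n = \<lparr>verts = {1..n}, edges = {{i, i + 1} | i. 1 \<le> i \<and> i < n}\<rparr>"

definition bipartition :: "'a ugraph \<Rightarrow> 'a set \<Rightarrow> 'a set \<Rightarrow> bool" where
  "bipartition G X Y \<longleftrightarrow> X \<union> Y = verts G \<and> X \<inter> Y = {} \<and>
     (\<forall>u v. adj G u v \<longrightarrow> (u \<in> X \<and> v \<in> Y) \<or> (u \<in> Y \<and> v \<in> X))"

definition has_balanced_bipartition :: "'a ugraph \<Rightarrow> bool" where
  "has_balanced_bipartition G \<longleftrightarrow> (\<exists>X Y. bipartition G X Y \<and>
     (if even (card (verts G)) then card X = card Y
      else \<bar>int (card X) - int (card Y)\<bar> = 1))"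

definition minimizers :: "nat \<Rightarrow> 'b ugraph \<Rightarrow> 'a ugraph set" where
  "minimizers n H = {T \<in> trees n. \<forall>T'\<in>(trees n :: 'a ugraph set). hom T H \<le> hom T' H}"

text \<open>
  Entry number \<open>i\<close> (counting from 1) of the table gives the number of vertices and the
  edge set of \<open>H\<^sub>i\<close>.
\<close>

definition H_table :: "(nat \<times> nat set set) list" where
  "H_table =
    [(1, {}),
     (1, {{1,1}}),
     (2, {}),
     (2, {{2,2}}),
     (2, {{1,1}, {2,2}}),
     (2, {{1,2}}),
     (2, {{1,2}, {2,2}}),
     (2, {{1,2}, {1,1}, {2,2}}),
     (3, {}),
     (3, {{2,2}}),
     (3, {{1,1}, {3,3}}),
     (3, {{1,1}, {2,2}, {3,3}}),
     (3, {{1,2}}),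
     (3, {{1,2}, {3,3}}),
     (3, {{1,2}, {1,1}}),
     (3, {{1,2}, {1,1}, {3,3}}),
     (3, {{1,2}, {1,1}, {2,2}}),
     (3, {{1,2}, {1,1}, {2,2}, {3,3}}),
     (3, {{1,2}, {2,3}}),
     (3, {{1,2}, {2,3}, {1,1}}),
     (3, {{1,2}, {2,3}, {2,2}}),
     (3, {{1,2}, {2,3}, {2,2}, {3,3}}),
     (3, {{1,2}, {2,3}, {1,1}, {3,3}}),
     (3, {{1,2}, {2,3}, {1,1}, {2,2}, {3,3}}),
     (3, {{1,2}, {2,3}, {1,3}}),
     (3, {{1,2}, {2,3}, {1,3}, {1,1}}),
     (3, {{1,2}, {2,3}, {1,3}, {1,1}, {2,2}}),
     (3, {{1,2}, {2,3}, {1,3}, {1,1}, {2,2}, {3,3}})]"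

definition H_graph :: "nat \<Rightarrow> nat ugraph" where
  "H_graph i = \<lparr>verts = {1..fst (H_table ! (i - 1))}, edges = snd (H_table ! (i - 1))\<rparr>"

definition all_minimize :: "'a itself \<Rightarrow> nat \<Rightarrow> 'b ugraph \<Rightarrow> nat \<Rightarrow> bool" where
  "all_minimize _ n H c \<longleftrightarrow>
     minimizers n H = (trees n :: 'a ugraph set) \<and> (\<forall>T\<in>(trees n :: 'a ugraph set). hom T H = c)"

end

theory Submission
  imports Defs
begin

text \<open>
  For a tree \<open>T\<close> with root \<open>r\<close>, let \<open>v T\<close> be the vector whose entry at \<open>i\<close> counts the colorings
  with \<open>r\<close> coloured \<open>i\<close>. Deleting an edge \<open>rs\<close> gives \<open>v T = (M (v T1)) * v T2\<close> (entrywise product,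
  \<open>M\<close> the adjacency matrix of \<open>H\<close>), so all statements about \<open>hom T H\<close> reduce to inductions over such
  splittings. If the degree is constant on the components of \<open>H\<close>, then \<open>v T\<close> does not depend on the
  shape of \<open>T\<close>; for \<open>H\<^sub>1\<^sub>9\<close> it depends only on the sizes of the two classes of \<open>T\<close>.

  In case (iii) the vertices of \<open>H\<close> can be ranked so that monotone vectors are preserved by \<open>M\<close>
  and by entrywise products. For monotone \<open>a\<close>, \<open>b\<close> one has \<open>\<Sum>i. a i * b i * (M^k 1) i \<ge> \<Sum>i. a i * (M^k b) i\<close>,
  i.e. moving the branch \<open>b\<close> to the far end of a path with \<open>k\<close> edges does not increase the count.
  Repeated moves straighten the tree into a path, and strict monotonicity makes
  the path the only minimizer.
\<close>

subsection \<open>Splitting a tree at an edge\<close>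

lemma adj_commute: "adj G u v \<longleftrightarrow> adj G v u"
  by (simp add: adj_def insert_commute)

lemma adj_in_verts:
  assumes "loop_graph G" "adj G u v"
  shows "u \<in> verts G" "v \<in> verts G"
  using assms by (auto simp: loop_graph_def adj_def)

lemma loop_graph_finite: "loop_graph G \<Longrightarrow> finite (verts G)"
  by (simp add: loop_graph_def)

lemma tree_loop_graph: "tree T \<Longrightarrow> loop_graph T"
  by (simp add: tree_def simple_graph_def)

lemma tree_irrefl: "tree T \<Longrightarrow> \<not> adj T v v"
  by (meson adj_in_verts(1) simple_graph_def tree_def)

lemma tree_connected: "tree T \<Longrightarrow> u \<in> verts T \<Longrightarrow> v \<in> verts T \<Longrightarrow> (adj T)\<^sup>*\<^sup>* u v"
  by (simp add: tree_def connected_graph_def)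

text \<open>Repetitions are erased while the walk is built from its end: if the new first vertex
  already occurs, everything before that occurrence is dropped.\<close>

lemma rtranclp_distinct_walk:
  assumes "R\<^sup>*\<^sup>* x y"
  shows "\<exists>xs. xs \<noteq> [] \<and> hd xs = x \<and> last xs = y \<and> distinct xs \<and> successively R xs"
  using assms
proof (induction rule: converse_rtranclp_induct)
  case base
  show ?case by (rule exI[of _ "[y]"]) simp
next
  case (step x z)
  then obtain xs where xs: "xs \<noteq> []" "hd xs = z" "last xs = y" "distinct xs" "successively R xs"
    by blast
  show ?case
  proof (cases "x \<in> set xs")
    case True
    then obtain ys zs where "xs = ys @ x # zs"
      by (meson split_list)
    with xs show ?thesis
      by (intro exI[of _ "x # zs"]) (auto simp: successively_append_iff)
  next
    case False
    with xs step show ?thesis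
      by (intro exI[of _ "x # xs"]) (auto simp: successively_Cons)
  qed
qed

text \<open>The roles are asymmetric: \<open>T2\<close> carries the root \<open>r\<close> of
  \<open>T\<close>, and \<open>T1\<close> is a branch hanging from \<open>r\<close> at its own root
  \<open>s\<close>. Requiring \<open>loop_graph\<close> keeps all adjacencies of the two parts
  inside their vertex sets.\<close>

definition edge_join :: "'a ugraph \<Rightarrow> 'a ugraph \<Rightarrow> 'a \<Rightarrow> 'a ugraph \<Rightarrow> 'a \<Rightarrow> bool" where
  "edge_join T T1 s T2 r \<longleftrightarrow>
     verts T = verts T1 \<union> verts T2 \<and> verts T1 \<inter> verts T2 = {} \<and> s \<in> verts T1 \<and> r \<in> verts T2 \<and>
     loop_graph T1 \<and> loop_graph T2 \<and>
     (\<forall>u v. adj T u v \<longleftrightarrow> adj T1 u v \<or> adj T2 u v \<or> (u = s \<and> v = r) \<or> (u = r \<and> v = s))"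

text \<open>The parts are the components of \<open>s\<close> and \<open>r\<close> once some edge
  \<open>rs\<close> at the root is deleted. Connectedness shows that they cover \<open>T\<close>,
  acyclicity that they are disjoint.\<close>

lemma tree_split:
  assumes T: "tree T" and r: "r \<in> verts T" and ne: "verts T \<noteq> {r}"
  obtains T1 s T2 where "tree T1" "tree T2" "edge_join T T1 s T2 r"
proof -
  from r ne obtain w where w: "w \<in> verts T" "w \<noteq> r" by blast
  then obtain s where s: "adj T r s"
    using tree_connected[OF T r w(1)] by (metis converse_rtranclpE)
  note lg = tree_loop_graph[OF T]
  have sv: "s \<in> verts T" using adj_in_verts[OF lg s] by simp
  have rs: "r \<noteq> s" using s tree_irrefl[OF T] by metis
  define E where "E u v \<longleftrightarrow> adj T u v \<and> {u, v} \<noteq> {r, s}" for u v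
  have E_sym: "E u v \<longleftrightarrow> E v u" for u v
    by (auto simp: E_def adj_commute insert_commute)
  have E_star_sym: "E\<^sup>*\<^sup>* u v \<Longrightarrow> E\<^sup>*\<^sup>* v u" for u v
    using E_sym by (metis symp_rtranclp symp_def)
  \<comment> \<open>A walk from \<open>s\<close> to \<open>r\<close> without repetitions and without
    the edge \<open>rs\<close> has at least three vertices, so the edge \<open>rs\<close> closes it
    to a cycle.\<close>
  have no_walk: "\<not> E\<^sup>*\<^sup>* s r"
  proof
    assume "E\<^sup>*\<^sup>* s r"
    then obtain xs where xs: "xs \<noteq> []" "hd xs = s" "last xs = r" "distinct xs" "successively E xs"
      using rtranclp_distinct_walk by metis
    have len: "3 \<le> length xs"
    proof (rule ccontr)
      assume "\<not> 3 \<le> length xs"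
      then have "length xs = 0 \<or> length xs = 1 \<or> length xs = 2" by arith
      then show False
        using xs rs by (auto simp: length_Suc_conv numeral_2_eq_2 E_def insert_commute)
    qed
    have "adj T (xs ! i) (xs ! (Suc i mod length xs))" if i: "i < length xs" for i
    proof (cases "Suc i < length xs")
      case True
      with xs(5) show ?thesis by (auto simp: successively_conv_nth E_def)
    next
      case False
      with i have "Suc i = length xs" by simp
      then have "xs ! i = r" "xs ! (Suc i mod length xs) = s"
        using xs by (auto simp: last_conv_nth hd_conv_nth dest: arg_cong[of _ _ "\<lambda>n. n - 1"])
      then show ?thesis using s by simp
    qed
    then have "is_cycle T xs" using len xs by (simp add: is_cycle_def)
    then show False using T by (auto simp: tree_def)
  qed
  define comp where "comp x = \<lparr>verts = {v. E\<^sup>*\<^sup>* x v},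
     edges = {e \<in> edges T. e \<noteq> {r, s} \<and> (\<forall>v\<in>e. E\<^sup>*\<^sup>* x v)}\<rparr>" for x
  have comp_adj: "adj (comp x) u v \<longleftrightarrow> E u v \<and> E\<^sup>*\<^sup>* x u \<and> E\<^sup>*\<^sup>* x v" for x u v
    by (auto simp: comp_def adj_def E_def)
  have comp_verts: "v \<in> verts (comp x) \<longleftrightarrow> E\<^sup>*\<^sup>* x v" for x v
    by (simp add: comp_def)
  have star_verts: "v \<in> verts T" if "E\<^sup>*\<^sup>* x v" "x \<in> verts T" for x v
    using that by induction (auto simp: E_def dest: adj_in_verts[OF lg])
  have comp_tree: "tree (comp x)" if x: "x \<in> verts T" for x
  proof -
    have fin: "finite (verts (comp x))"
      using star_verts x by (intro finite_subset[OF _ loop_graph_finite[OF lg]]) (auto simp: comp_verts)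
    have "loop_graph (comp x)"
      using lg fin by (auto simp: loop_graph_def comp_def)
    moreover have "\<not> adj (comp x) v v" for v
      using tree_irrefl[OF T] by (simp add: comp_adj E_def)
    moreover have "connected_graph (comp x)"
    proof -
      have reach: "(adj (comp x))\<^sup>*\<^sup>* x v" if "E\<^sup>*\<^sup>* x v" for v
        using that
      proof induction
        case (step y z)
        then have "adj (comp x) y z" by (auto simp: comp_adj intro: rtranclp.rtrancl_into_rtrancl)
        with step show ?case by auto
      qed simp
      have "(adj (comp x))\<^sup>*\<^sup>* v x" if "E\<^sup>*\<^sup>* x v" for v
        using reach[OF that] adj_commute[of "comp x"] by (metis symp_rtranclp symp_def)
      with reach show ?thesis
        unfolding connected_graph_def comp_verts
        by (metis (no_types, lifting) comp_verts empty_iff rtranclp.rtrancl_refl rtranclp_trans)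
    qed
    moreover have "\<not> is_cycle (comp x) xs" for xs
    proof
      assume "is_cycle (comp x) xs"
      then have "is_cycle T xs" by (auto simp: is_cycle_def comp_adj E_def)
      then show False using T by (auto simp: tree_def)
    qed
    ultimately show ?thesis by (simp add: tree_def simple_graph_def)
  qed
  \<comment> \<open>Follow a walk from \<open>r\<close>: a step along the deleted edge lands on
    \<open>r\<close> or \<open>s\<close>, every other step stays in the current component.\<close>
  have cover: "E\<^sup>*\<^sup>* s v \<or> E\<^sup>*\<^sup>* r v" if "v \<in> verts T" for v
    using tree_connected[OF T r that]
  proof induction
    case (step y z)
    show ?case
    proof (cases "{y, z} = {r, s}")
      case True
      then show ?thesis by (auto simp: doubleton_eq_iff)
    next
      case False
      with step have "E y z" by (simp add: E_def)
      with step show ?thesis by (auto intro: rtranclp.rtrancl_into_rtrancl)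
    qed
  qed simp
  have disj: "\<not> (E\<^sup>*\<^sup>* s v \<and> E\<^sup>*\<^sup>* r v)" for v
    using no_walk E_star_sym by (meson rtranclp_trans)
  have "edge_join T (comp s) s (comp r) r"
    unfolding edge_join_def
  proof (intro conjI allI)
    show "verts T = verts (comp s) \<union> verts (comp r)"
      using cover star_verts[OF _ r] star_verts[OF _ sv] unfolding set_eq_iff Un_iff comp_verts by blast
    show "verts (comp s) \<inter> verts (comp r) = {}"
      using disj by (auto simp: comp_verts)
    show "s \<in> verts (comp s)" "r \<in> verts (comp r)" by (simp_all add: comp_verts)
    show "loop_graph (comp s)" "loop_graph (comp r)"
      using comp_tree r sv tree_loop_graph by blast+
    fix u v
    have "adj (comp s) u v \<or> adj (comp r) u v" if "adj T u v" "{u, v} \<noteq> {r, s}"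
    proof -
      have E: "E u v" using that by (simp add: E_def)
      have "u \<in> verts T" using adj_in_verts[OF lg that(1)] by simp
      then show ?thesis using E cover[of u]
        by (auto simp: comp_adj intro: rtranclp.rtrancl_into_rtrancl)
    qed
    then show "adj T u v \<longleftrightarrow>
       adj (comp s) u v \<or> adj (comp r) u v \<or> (u = s \<and> v = r) \<or> (u = r \<and> v = s)"
      using s adj_commute[of T r s] by (auto simp: comp_adj E_def doubleton_eq_iff)
  qed
  with comp_tree r sv that show thesis by blast
qed

lemma edge_join_card:
  assumes "edge_join T T1 s T2 r"
  shows "card (verts T) = card (verts T1) + card (verts T2)"
    "0 < card (verts T1)" "0 < card (verts T2)"
  using assms by (auto simp: edge_join_def card_Un_disjoint loop_graph_finite card_gt_0_iff)

text \<open>Induction for rooted trees. The branch \<open>T1\<close> is rooted at \<open>s\<close>,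
  so properties proved this way must be stated for every root.\<close>

lemma tree_induct [consumes 2, case_names single join]:
  assumes "tree T" "r \<in> verts T"
    and "\<And>T r. tree T \<Longrightarrow> verts T = {r} \<Longrightarrow> P T r"
    and "\<And>T T1 s T2 r. tree T1 \<Longrightarrow> tree T2 \<Longrightarrow> edge_join T T1 s T2 r \<Longrightarrow>
      P T1 s \<Longrightarrow> P T2 r \<Longrightarrow> P T r"
  shows "P T r"
  using assms(1,2)
proof (induction "card (verts T)" arbitrary: T r rule: less_induct)
  case less
  show ?case
  proof (cases "verts T = {r}")
    case False
    then obtain T1 s T2 where J: "tree T1" "tree T2" "edge_join T T1 s T2 r"
      using tree_split less.prems by metis
    moreover have "P T1 s" "P T2 r"
      using J edge_join_card[OF J(3)] by (auto intro!: less.hyps simp: edge_join_def)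
    ultimately show ?thesis using assms(4) by blast
  qed (use less.prems assms(3) in blast)
qed

section \<open>Counting colorings by the colour of the root\<close>

definition root_count :: "'a ugraph \<Rightarrow> 'b ugraph \<Rightarrow> 'a \<Rightarrow> 'b \<Rightarrow> nat" where
  "root_count G H r i = card {f \<in> colorings G H. f r = i}"

text \<open>The adjacency matrix of \<open>H\<close> applied to the vector \<open>a\<close>; a loop
  contributes its vertex once.\<close>

definition nsum :: "'b ugraph \<Rightarrow> ('b \<Rightarrow> nat) \<Rightarrow> 'b \<Rightarrow> nat" where
  "nsum H a i = (\<Sum>j\<in>verts H. if adj H i j then a j else 0)"

lemma colorings_finite:
  assumes "finite (verts G)" "finite (verts H)"
  shows "finite (colorings G H)"
proof (rule finite_subset)
  show "colorings G H \<subseteq> verts G \<rightarrow>\<^sub>E verts H" by (auto simp: colorings_def)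
  show "finite (verts G \<rightarrow>\<^sub>E verts H)" using assms by (intro finite_PiE)
qed

lemma hom_eq_sum_root_count:
  assumes "finite (verts G)" "finite (verts H)" "r \<in> verts G"
  shows "hom G H = (\<Sum>i\<in>verts H. root_count G H r i)"
proof -
  have "colorings G H = (\<Union>i\<in>verts H. {f \<in> colorings G H. f r = i})"
    using assms by (auto simp: colorings_def)
  also have "card \<dots> = (\<Sum>i\<in>verts H. root_count G H r i)"
    unfolding root_count_def
    using assms colorings_finite[OF assms(1,2)] by (subst card_UN_disjoint) auto
  finally show ?thesis by (simp add: hom_def)
qed

lemma root_count_single:
  assumes "verts G = {r}" "\<not> adj G r r" "i \<in> verts H"
  shows "root_count G H r i = 1"
proof -
  have "f \<in> colorings G H \<and> f r = i \<longleftrightarrow> f = (\<lambda>v\<in>{r}. i)" for f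
  proof
    assume "f \<in> colorings G H \<and> f r = i"
    then have "f \<in> extensional {r}" "f r = i"
      using assms(1) by (auto simp: colorings_def PiE_iff)
    then show "f = (\<lambda>v\<in>{r}. i)" by (intro extensionalityI[of _ "{r}"]) auto
  next
    assume "f = (\<lambda>v\<in>{r}. i)"
    then show "f \<in> colorings G H \<and> f r = i" using assms by (simp add: colorings_def)
  qed
  then have "{f \<in> colorings G H. f r = i} = {\<lambda>v\<in>{r}. i}" by auto
  then show ?thesis by (simp add: root_count_def)
qed

text \<open>Restriction to the two parts is a bijection onto pairs of colorings. The only constraint
  linking the two is the edge \<open>sr\<close>: the colour of \<open>s\<close> must be a neighbour
  of \<open>i\<close>.\<close>

lemma root_count_join:
  assumes J: "edge_join T T1 s T2 r" and fin: "finite (verts H)"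
  shows "root_count T H r i = nsum H (root_count T1 H s) i * root_count T2 H r i"
proof -
  let ?V1 = "verts T1" and ?V2 = "verts T2"
  from J have V: "verts T = ?V1 \<union> ?V2" "?V1 \<inter> ?V2 = {}" "s \<in> ?V1" "r \<in> ?V2"
    and lg: "loop_graph T1" "loop_graph T2"
    and adj: "\<And>u v. adj T u v \<longleftrightarrow> adj T1 u v \<or> adj T2 u v \<or> (u = s \<and> v = r) \<or> (u = r \<and> v = s)"
    by (auto simp: edge_join_def)
  note adj1 = adj_in_verts[OF lg(1)] and adj2 = adj_in_verts[OF lg(2)]
  let ?F = "{f \<in> colorings T H. f r = i}"
  let ?A = "{f \<in> colorings T1 H. adj H i (f s)}" and ?B = "{f \<in> colorings T2 H. f r = i}"
  let ?glue = "\<lambda>(g, h). \<lambda>v\<in>?V1 \<union> ?V2. if v \<in> ?V1 then g v else h v"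
  have "bij_betw (\<lambda>f. (restrict f ?V1, restrict f ?V2)) ?F (?A \<times> ?B)"
  proof (rule bij_betw_byWitness[where f' = ?glue])
    show "\<forall>f\<in>?F. ?glue (restrict f ?V1, restrict f ?V2) = f"
      using V by (auto simp: colorings_def PiE_iff extensional_def fun_eq_iff)
    show "\<forall>p\<in>?A \<times> ?B. (restrict (?glue p) ?V1, restrict (?glue p) ?V2) = p"
    proof
      fix p assume "p \<in> ?A \<times> ?B"
      then obtain g h where p: "p = (g, h)" and "g \<in> extensional ?V1" "h \<in> extensional ?V2"
        by (auto simp: colorings_def PiE_iff)
      then have "restrict (?glue p) ?V1 = g" "restrict (?glue p) ?V2 = h"
        using V(2) by (auto simp: extensional_def fun_eq_iff)
      with p show "(restrict (?glue p) ?V1, restrict (?glue p) ?V2) = p" by simp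
    qed
    show "(\<lambda>f. (restrict f ?V1, restrict f ?V2)) ` ?F \<subseteq> ?A \<times> ?B"
    proof
      fix p assume "p \<in> (\<lambda>f. (restrict f ?V1, restrict f ?V2)) ` ?F"
      then obtain f where f: "f \<in> colorings T H" "f r = i"
        and p: "p = (restrict f ?V1, restrict f ?V2)" by auto
      have "adj H i (f s)"
        using f V adj[of r s] by (auto simp: colorings_def)
      then show "p \<in> ?A \<times> ?B"
        using f V adj by (auto simp: p colorings_def PiE_iff)
    qed
    show "?glue ` (?A \<times> ?B) \<subseteq> ?F"
    proof
      fix f assume "f \<in> ?glue ` (?A \<times> ?B)"
      then obtain g h where g: "g \<in> colorings T1 H" "adj H i (g s)"
        and h: "h \<in> colorings T2 H" "h r = i"
        and f: "f = (\<lambda>v\<in>?V1 \<union> ?V2. if v \<in> ?V1 then g v else h v)" by auto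
      have f1: "f v = g v" if "v \<in> ?V1" for v using that by (simp add: f)
      have f2: "f v = h v" if "v \<in> ?V2" for v using that V(2) by (auto simp: f)
      have "f \<in> verts T \<rightarrow>\<^sub>E verts H"
        using g h V by (auto simp: f colorings_def PiE_iff)
      moreover have "adj H (f u) (f v)" if "adj T u v" for u v
        using that unfolding adj
      proof (elim disjE conjE)
        assume "adj T1 u v"
        then show ?thesis using g adj1 by (simp add: f1 colorings_def)
      next
        assume "adj T2 u v"
        then show ?thesis using h adj2 by (simp add: f2 colorings_def)
      next
        assume "u = s" "v = r"
        then show ?thesis using g h V f1 f2 adj_commute[of H i] by simp
      next
        assume "u = r" "v = s"
        then show ?thesis using g h V f1 f2 by simp
      qed
      moreover have "f r = i" using f2[OF V(4)] h by simp
      ultimately show "f \<in> ?F" by (auto simp: colorings_def)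
    qed
  qed
  then have "card ?F = card ?A * card ?B"
    by (simp add: bij_betw_same_card card_cartesian_product)
  moreover have "card ?A = nsum H (root_count T1 H s) i"
  proof -
    have finc: "finite (colorings T1 H)"
      using colorings_finite loop_graph_finite lg(1) fin by blast
    have "?A = (\<Union>j\<in>{j\<in>verts H. adj H i j}. {f \<in> colorings T1 H. f s = j})"
      using V(3) by (auto simp: colorings_def)
    also have "card \<dots> = (\<Sum>j\<in>{j\<in>verts H. adj H i j}. root_count T1 H s j)"
      unfolding root_count_def using fin finc by (subst card_UN_disjoint) auto
    also have "\<dots> = nsum H (root_count T1 H s) i"
      using fin by (simp add: nsum_def sum.inter_filter)
    finally show ?thesis .
  qed
  ultimately show ?thesis by (simp add: root_count_def)
qed

subsection \<open>Isomorphisms and paths\<close>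

lemma graph_iso_refl: "graph_iso G G"
  unfolding graph_iso_def by (rule exI[of _ id]) simp

lemma graph_iso_sym:
  assumes "graph_iso G H"
  shows "graph_iso H G"
proof -
  from assms obtain \<phi> where \<phi>: "bij_betw \<phi> (verts G) (verts H)"
    and adj: "\<forall>u\<in>verts G. \<forall>v\<in>verts G. adj G u v \<longleftrightarrow> adj H (\<phi> u) (\<phi> v)"
    unfolding graph_iso_def by blast
  let ?\<psi> = "inv_into (verts G) \<phi>"
  have \<psi>: "bij_betw ?\<psi> (verts H) (verts G)" using \<phi> by (rule bij_betw_inv_into)
  moreover have "adj H u v \<longleftrightarrow> adj G (?\<psi> u) (?\<psi> v)" if "u \<in> verts H" "v \<in> verts H" for u v
    using adj that bij_betw_apply[OF \<psi>] bij_betw_inv_into_right[OF \<phi>] by simp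
  ultimately show ?thesis unfolding graph_iso_def by blast
qed

lemma graph_iso_card: "graph_iso G H \<Longrightarrow> card (verts G) = card (verts H)"
  by (auto simp: graph_iso_def dest: bij_betw_same_card)

text \<open>A coloring is transported by precomposing with an isomorphism \<open>G'\<close> to
  \<open>G\<close> and postcomposing with one from \<open>H\<close> to \<open>H'\<close>.
  Injectivity of this map suffices, since equality follows by symmetry.\<close>

lemma hom_mono_iso:
  assumes G: "graph_iso G G'" and H: "graph_iso H H'"
    and fin: "finite (verts G')" "finite (verts H')"
  shows "hom G H \<le> hom G' H'"
proof -
  from graph_iso_sym[OF G] obtain \<phi> where \<phi>: "bij_betw \<phi> (verts G') (verts G)"
    and adjG: "\<And>u v. u \<in> verts G' \<Longrightarrow> v \<in> verts G' \<Longrightarrow> adj G' u v \<longleftrightarrow> adj G (\<phi> u) (\<phi> v)"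
    unfolding graph_iso_def by blast
  from H obtain \<psi> where \<psi>: "bij_betw \<psi> (verts H) (verts H')"
    and adjH: "\<And>u v. u \<in> verts H \<Longrightarrow> v \<in> verts H \<Longrightarrow> adj H u v \<longleftrightarrow> adj H' (\<psi> u) (\<psi> v)"
    unfolding graph_iso_def by blast
  let ?t = "\<lambda>f. \<lambda>v\<in>verts G'. \<psi> (f (\<phi> v))"
  have "inj_on ?t (colorings G H)"
  proof (rule inj_onI)
    fix f g assume f: "f \<in> colorings G H" and g: "g \<in> colorings G H" and eq: "?t f = ?t g"
    have "f x = g x" if x: "x \<in> verts G" for x
    proof -
      obtain v where v: "v \<in> verts G'" "x = \<phi> v" using \<phi> x by (auto simp: bij_betw_def)
      then have "\<psi> (f x) = \<psi> (g x)" using fun_cong[OF eq, of v] by simp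
      moreover have "f x \<in> verts H" "g x \<in> verts H" using f g x by (auto simp: colorings_def)
      ultimately show ?thesis using \<psi> by (auto simp: bij_betw_def dest: inj_onD)
    qed
    moreover have "f \<in> extensional (verts G)" "g \<in> extensional (verts G)"
      using f g by (auto simp: colorings_def PiE_iff)
    ultimately show "f = g" by (rule extensionalityI[rotated 2])
  qed
  moreover have "?t f \<in> colorings G' H'" if f: "f \<in> colorings G H" for f
  proof -
    have fv: "f (\<phi> v) \<in> verts H" if "v \<in> verts G'" for v
      using f that bij_betw_apply[OF \<phi>] by (auto simp: colorings_def)
    have "adj H (f (\<phi> u)) (f (\<phi> v))" if "u \<in> verts G'" "v \<in> verts G'" "adj G' u v" for u v
      using f that adjG bij_betw_apply[OF \<phi>] by (auto simp: colorings_def)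
    with fv show ?thesis
      using bij_betw_apply[OF \<psi>] adjH by (auto simp: colorings_def)
  qed
  ultimately show ?thesis
    unfolding hom_def using colorings_finite[OF fin] by (intro card_inj_on_le) auto
qed

lemma hom_iso:
  assumes "graph_iso G G'" "graph_iso H H'"
    and "loop_graph G" "loop_graph G'" "loop_graph H" "loop_graph H'"
  shows "hom G H = hom G' H'"
proof (rule antisym)
  show "hom G H \<le> hom G' H'"
    using assms by (intro hom_mono_iso loop_graph_finite)
  show "hom G' H' \<le> hom G H"
    using assms(3-6) by (intro hom_mono_iso graph_iso_sym[OF assms(1)] graph_iso_sym[OF assms(2)] loop_graph_finite)
qed

lemma tree_iso:
  assumes T: "tree T" and iso: "graph_iso T G" and G: "loop_graph G"
  shows "tree G"
proof -
  from graph_iso_sym[OF iso] obtain \<phi> where \<phi>: "bij_betw \<phi> (verts G) (verts T)"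
    and adj: "\<And>u v. u \<in> verts G \<Longrightarrow> v \<in> verts G \<Longrightarrow> adj G u v \<longleftrightarrow> adj T (\<phi> u) (\<phi> v)"
    unfolding graph_iso_def by blast
  have inj: "inj_on \<phi> (verts G)" using \<phi> by (simp add: bij_betw_def)
  have irr: "\<not> adj G v v" for v
    using adj adj_in_verts[OF G] tree_irrefl[OF T] by metis
  have ne: "verts G \<noteq> {}"
    using T \<phi> by (auto simp: tree_def connected_graph_def bij_betw_def)
  \<comment> \<open>The claim speaks about all preimages of the current endpoint, so that the
    induction can run along a walk in \<open>T\<close>.\<close>
  have walk: "\<forall>v\<in>verts G. y = \<phi> v \<longrightarrow> (adj G)\<^sup>*\<^sup>* u v"
    if "(adj T)\<^sup>*\<^sup>* (\<phi> u) y" "u \<in> verts G" for u y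
    using that
  proof induction
    case base
    then show ?case using inj by (auto dest: inj_onD)
  next
    case (step y z)
    have "y \<in> verts T" using adj_in_verts[OF tree_loop_graph[OF T] step(2)] by simp
    then obtain w where w: "w \<in> verts G" "y = \<phi> w" using \<phi> by (auto simp: bij_betw_def)
    with step show ?case
      by (metis adj rtranclp.rtrancl_into_rtrancl)
  qed
  have conn: "connected_graph G"
    unfolding connected_graph_def
    using ne walk tree_connected[OF T] bij_betw_apply[OF \<phi>] by blast
  have "\<not> is_cycle G xs" for xs
  proof
    assume c: "is_cycle G xs"
    have v: "xs ! i \<in> verts G" if "i < length xs" for i
      using c that adj_in_verts[OF G] by (auto simp: is_cycle_def)
    then have "set xs \<subseteq> verts G" by (auto simp: in_set_conv_nth)
    then have "distinct (map \<phi> xs)"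
      using c inj by (auto simp: is_cycle_def distinct_map intro: inj_on_subset)
    moreover have "adj T (map \<phi> xs ! i) (map \<phi> xs ! (Suc i mod length xs))" if i: "i < length xs" for i
    proof -
      have "Suc i mod length xs < length xs" using i by (intro mod_less_divisor) linarith
      with i show ?thesis using c adj[OF v v, of i "Suc i mod length xs"]
        by (simp add: is_cycle_def)
    qed
    ultimately have "is_cycle T (map \<phi> xs)" using c by (simp add: is_cycle_def)
    then show False using T by (auto simp: tree_def)
  qed
  with G irr conn show ?thesis by (simp add: tree_def simple_graph_def)
qed

lemma path_graph_adj:
  "adj (path_graph n) u v \<longleftrightarrow> u \<in> {1..n} \<and> v \<in> {1..n} \<and> (u = Suc v \<or> v = Suc u)"
  by (auto simp: adj_def path_graph_def doubleton_eq_iff)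

lemma path_graph_verts: "verts (path_graph n) = {1..n}"
  by (simp add: path_graph_def)

lemma path_graph_loop_graph: "loop_graph (path_graph n)"
  by (auto simp: loop_graph_def path_graph_def)

text \<open>There is no cycle: the largest number on it would have two distinct cyclic neighbours,
  yet both would have to be its predecessor.\<close>

lemma path_graph_tree:
  assumes "1 \<le> n"
  shows "tree (path_graph n)"
proof -
  let ?P = "path_graph n"
  have sym: "(adj ?P)\<^sup>*\<^sup>* u v \<Longrightarrow> (adj ?P)\<^sup>*\<^sup>* v u" for u v
    using adj_commute[of ?P] by (metis symp_rtranclp symp_def)
  have reach: "1 \<le> k \<Longrightarrow> k \<le> n \<Longrightarrow> (adj ?P)\<^sup>*\<^sup>* 1 k" for k
  proof (induction k)
    case (Suc k)
    show ?case
    proof (cases "k = 0")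
      case False
      with Suc have "(adj ?P)\<^sup>*\<^sup>* 1 k" by simp
      moreover have "adj ?P k (Suc k)" using False Suc.prems by (subst path_graph_adj) simp
      ultimately show ?thesis by (rule rtranclp.rtrancl_into_rtrancl)
    qed simp
  qed simp
  have "(adj ?P)\<^sup>*\<^sup>* u v" if "u \<in> {1..n}" "v \<in> {1..n}" for u v
    using rtranclp_trans[OF sym[OF reach] reach] that by simp
  then have "connected_graph ?P"
    unfolding connected_graph_def path_graph_verts using assms by simp
  moreover have "\<not> is_cycle ?P xs" for xs
  proof
    assume c: "is_cycle ?P xs"
    define m where "m = Max (set xs)"
    have len: "3 \<le> length xs" and d: "distinct xs" using c by (auto simp: is_cycle_def)
    have "m \<in> set xs" unfolding m_def using len by (intro Max_in) auto
    then obtain i where i: "i < length xs" "xs ! i = m" by (auto simp: in_set_conv_nth)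
    have le: "xs ! j \<le> m" if "j < length xs" for j
      using that by (simp add: m_def)
    \<comment> \<open>\<open>p\<close> and \<open>q\<close> are the positions cyclically before and
      after \<open>i\<close>; they differ because the cycle has length at least three.\<close>
    define p where "p = (if i = 0 then length xs - 1 else i - 1)"
    define q where "q = Suc i mod length xs"
    have p: "p < length xs" "Suc p mod length xs = i"
      using i len by (auto simp: p_def)
    have q: "q < length xs" unfolding q_def using i by (intro mod_less_divisor) linarith
    have "p \<noteq> q"
      using i len by (auto simp: p_def q_def mod_Suc)
    have "adj ?P (xs ! p) m" "adj ?P m (xs ! q)"
      using c p i unfolding is_cycle_def q_def by metis+
    then have "xs ! p = xs ! q"
      using le[OF p(1)] le[OF q] by (auto simp: path_graph_adj)
    then show False using d p q \<open>p \<noteq> q\<close> by (simp add: nth_eq_iff_index_eq)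
  qed
  ultimately show ?thesis
    by (auto simp: tree_def simple_graph_def path_graph_loop_graph path_graph_adj)
qed

section \<open>Paths with a marked end\<close>

definition end_path :: "'a ugraph \<Rightarrow> 'a \<Rightarrow> bool" where
  "end_path T r \<longleftrightarrow> (\<exists>\<phi>. bij_betw \<phi> (verts T) {1..card (verts T)} \<and> \<phi> r = card (verts T) \<and>
     (\<forall>u\<in>verts T. \<forall>v\<in>verts T. adj T u v \<longleftrightarrow> \<phi> u = Suc (\<phi> v) \<or> \<phi> v = Suc (\<phi> u)))"

lemma end_path_single:
  assumes "verts T = {r}" "\<not> adj T r r"
  shows "end_path T r"
  unfolding end_path_def using assms
  by (intro exI[of _ "\<lambda>_. 1"]) (auto simp: bij_betw_def)

text \<open>Two paths joined at their marked ends form one path. The root \<open>r\<close> need not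
  be an end of it, so the numbering itself is returned: it serves both when \<open>T2\<close> is a
  single vertex and when \<open>T\<close> is only to be recognised as a path.\<close>

lemma end_path_join:
  assumes J: "edge_join T T1 s T2 r" and "end_path T1 s" and "end_path T2 r"
  obtains \<phi> where "bij_betw \<phi> (verts T) {1..card (verts T)}" "\<phi> r = Suc (card (verts T1))"
    "\<forall>u\<in>verts T. \<forall>v\<in>verts T. adj T u v \<longleftrightarrow> \<phi> u = Suc (\<phi> v) \<or> \<phi> v = Suc (\<phi> u)"
proof -
  let ?V1 = "verts T1" and ?V2 = "verts T2"
  let ?m = "card ?V1" and ?k = "card ?V2" and ?n = "card (verts T)"
  obtain \<alpha> where \<alpha>: "bij_betw \<alpha> ?V1 {1..?m}" "\<alpha> s = ?m"
    and adj1: "\<And>u v. u \<in> ?V1 \<Longrightarrow> v \<in> ?V1 \<Longrightarrow> adj T1 u v \<longleftrightarrow> \<alpha> u = Suc (\<alpha> v) \<or> \<alpha> v = Suc (\<alpha> u)"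
    using assms(2) unfolding end_path_def by blast
  obtain \<beta> where \<beta>: "bij_betw \<beta> ?V2 {1..?k}" "\<beta> r = ?k"
    and adj2: "\<And>u v. u \<in> ?V2 \<Longrightarrow> v \<in> ?V2 \<Longrightarrow> adj T2 u v \<longleftrightarrow> \<beta> u = Suc (\<beta> v) \<or> \<beta> v = Suc (\<beta> u)"
    using assms(3) unfolding end_path_def by blast
  have n: "?n = ?m + ?k" using edge_join_card[OF J] by simp
  have V: "verts T = ?V1 \<union> ?V2" "?V1 \<inter> ?V2 = {}" "s \<in> ?V1" "r \<in> ?V2"
    and lg: "loop_graph T1" "loop_graph T2"
    and adj: "\<And>u v. adj T u v \<longleftrightarrow> adj T1 u v \<or> adj T2 u v \<or> (u = s \<and> v = r) \<or> (u = r \<and> v = s)"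
    using J by (auto simp: edge_join_def)
  \<comment> \<open>\<open>T1\<close> keeps its numbers and \<open>T2\<close> is numbered downwards
    from the top, so the ends \<open>s\<close> and \<open>r\<close> receive consecutive
    numbers.\<close>
  define \<phi> where "\<phi> v = (if v \<in> ?V1 then \<alpha> v else Suc ?n - \<beta> v)" for v
  have \<phi>1: "\<phi> v = \<alpha> v" if "v \<in> ?V1" for v using that by (simp add: \<phi>_def)
  have \<phi>2: "\<phi> v = Suc ?n - \<beta> v" if "v \<in> ?V2" for v using that V(2) by (auto simp: \<phi>_def)
  have r1: "1 \<le> \<alpha> v" "\<alpha> v \<le> ?m" if "v \<in> ?V1" for v
    using bij_betw_apply[OF \<alpha>(1) that] by auto
  have r2: "1 \<le> \<beta> v" "\<beta> v \<le> ?k" if "v \<in> ?V2" for v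
    using bij_betw_apply[OF \<beta>(1) that] by auto
  have i1: "\<alpha> u = \<alpha> v \<longleftrightarrow> u = v" if "u \<in> ?V1" "v \<in> ?V1" for u v
    using \<alpha>(1) that by (auto simp: bij_betw_def dest: inj_onD)
  have i2: "\<beta> u = \<beta> v \<longleftrightarrow> u = v" if "u \<in> ?V2" "v \<in> ?V2" for u v
    using \<beta>(1) that by (auto simp: bij_betw_def dest: inj_onD)
  have "bij_betw \<phi> ?V1 {1..?m}"
    using \<alpha>(1) by (rule bij_betw_cong[THEN iffD1, rotated]) (simp add: \<phi>1)
  moreover have "bij_betw \<phi> ?V2 {Suc ?m..?n}"
  proof -
    have "bij_betw (\<lambda>x. Suc ?n - x) {1..?k} {Suc ?m..?n}"
      by (rule bij_betw_byWitness[where f' = "\<lambda>x. Suc ?n - x"]) (auto simp: n)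
    from bij_betw_trans[OF \<beta>(1) this] show ?thesis
      by (rule bij_betw_cong[THEN iffD1, rotated]) (simp add: \<phi>2)
  qed
  ultimately have "bij_betw \<phi> (?V1 \<union> ?V2) ({1..?m} \<union> {Suc ?m..?n})"
    by (rule bij_betw_combine) auto
  moreover have "{1..?m} \<union> {Suc ?m..?n} = {1..?n}" using n by auto
  ultimately have bij: "bij_betw \<phi> (verts T) {1..?n}" using V(1) by simp
  have \<phi>r: "\<phi> r = Suc ?m" using \<phi>2[OF V(4)] \<beta>(2) n by simp
  have cross: "adj T u v \<longleftrightarrow> \<phi> u = Suc (\<phi> v) \<or> \<phi> v = Suc (\<phi> u)"
    if u: "u \<in> ?V1" and v: "v \<in> ?V2" for u v
  proof -
    have "adj T u v \<longleftrightarrow> u = s \<and> v = r"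
      using u v V(2-4) adj_in_verts[OF lg(1)] adj_in_verts[OF lg(2)] unfolding adj by blast
    also have "\<dots> \<longleftrightarrow> \<alpha> u = ?m \<and> \<beta> v = ?k"
      using i1[OF u V(3)] i2[OF v V(4)] \<alpha>(2) \<beta>(2) by simp
    also have "\<dots> \<longleftrightarrow> \<phi> u = Suc (\<phi> v) \<or> \<phi> v = Suc (\<phi> u)"
      using r1[OF u] r2[OF v] n by (auto simp: \<phi>1[OF u] \<phi>2[OF v])
    finally show ?thesis .
  qed
  have "adj T u v \<longleftrightarrow> \<phi> u = Suc (\<phi> v) \<or> \<phi> v = Suc (\<phi> u)"
    if uv: "u \<in> verts T" "v \<in> verts T" for u v
  proof -
    consider "u \<in> ?V1" "v \<in> ?V1" | "u \<in> ?V2" "v \<in> ?V2" | "u \<in> ?V1" "v \<in> ?V2" | "u \<in> ?V2" "v \<in> ?V1"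
      using uv V(1) by blast
    then show ?thesis
    proof cases
      case 1
      then have "adj T u v \<longleftrightarrow> adj T1 u v"
        using V(2-4) adj_in_verts[OF lg(2)] unfolding adj by blast
      with 1 show ?thesis by (simp add: adj1 \<phi>1)
    next
      case 2
      then have "adj T u v \<longleftrightarrow> adj T2 u v"
        using V(2-4) adj_in_verts[OF lg(1)] unfolding adj by blast
      also have "\<dots> \<longleftrightarrow> \<beta> u = Suc (\<beta> v) \<or> \<beta> v = Suc (\<beta> u)" using 2 by (rule adj2)
      also have "\<dots> \<longleftrightarrow> \<phi> u = Suc (\<phi> v) \<or> \<phi> v = Suc (\<phi> u)"
        unfolding \<phi>2[OF 2(1)] \<phi>2[OF 2(2)]
        using r2[OF 2(1)] r2[OF 2(2)] n by arith
      finally show ?thesis .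
    next
      case 3
      then show ?thesis by (rule cross)
    next
      case 4
      then show ?thesis using cross[of v u] adj_commute[of T u v] by blast
    qed
  qed
  with bij \<phi>r that show thesis by blast
qed

lemma iso_path_graphI:
  assumes "bij_betw \<phi> (verts T) {1..n}"
    "\<forall>u\<in>verts T. \<forall>v\<in>verts T. adj T u v \<longleftrightarrow> \<phi> u = Suc (\<phi> v) \<or> \<phi> v = Suc (\<phi> u)"
  shows "graph_iso T (path_graph n)"
  unfolding graph_iso_def path_graph_verts
  using assms bij_betw_apply[OF assms(1)] by (auto simp: path_graph_adj intro!: exI[of _ \<phi>])

text \<open>Walks of length \<open>k\<close> in \<open>H\<close> starting at a given vertex. They
  are the colorings of a path with \<open>k\<close> edges whose end has a prescribed colour.\<close>

abbreviation walks_from :: "'b ugraph \<Rightarrow> nat \<Rightarrow> 'b \<Rightarrow> nat" where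
  "walks_from H k \<equiv> (nsum H ^^ k) (\<lambda>_. 1)"

lemma nsum_cong: "(\<And>j. j \<in> verts H \<Longrightarrow> a j = b j) \<Longrightarrow> nsum H a i = nsum H b i"
  unfolding nsum_def by (intro sum.cong) auto

lemma root_count_path_graph:
  assumes "finite (verts H)" "i \<in> verts H"
  shows "root_count (path_graph (Suc k)) H (Suc k) i = walks_from H k i"
  using assms(2)
proof (induction k arbitrary: i)
  case 0
  then show ?case by (simp add: root_count_single path_graph_verts path_graph_adj)
next
  case (Suc k)
  \<comment> \<open>The new end vertex is the part carrying the root; the shorter path is the branch
    attached to it.\<close>
  let ?S = "\<lparr>verts = {Suc (Suc k)}, edges = {}\<rparr>"
  have "loop_graph ?S" by (simp add: loop_graph_def)
  then have "edge_join (path_graph (Suc (Suc k))) (path_graph (Suc k)) (Suc k) ?S (Suc (Suc k))"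
    unfolding edge_join_def path_graph_verts path_graph_adj
    by (auto simp: path_graph_loop_graph adj_def)
  from root_count_join[OF this assms(1)]
  have "root_count (path_graph (Suc (Suc k))) H (Suc (Suc k)) i =
    nsum H (root_count (path_graph (Suc k)) H (Suc k)) i"
    using Suc.prems by (simp add: root_count_single adj_def)
  also have "\<dots> = nsum H (walks_from H k) i"
    by (intro nsum_cong Suc.IH)
  finally show ?case by simp
qed

lemma hom_path_graph:
  assumes "finite (verts H)" "1 \<le> n"
  shows "hom (path_graph n) H = (\<Sum>i\<in>verts H. walks_from H (n - 1) i)"
proof -
  obtain k where "n = Suc k" using assms(2) by (cases n) auto
  then show ?thesis
    using hom_eq_sum_root_count[of "path_graph n" H n] assms root_count_path_graph[OF assms(1)]
    by (simp add: path_graph_verts)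
qed

subsection \<open>Targets with ranked vertices\<close>

definition ip :: "'b ugraph \<Rightarrow> ('b \<Rightarrow> nat) \<Rightarrow> ('b \<Rightarrow> nat) \<Rightarrow> nat" where
  "ip H a b = (\<Sum>i\<in>verts H. a i * b i)"

lemma ip_commute: "ip H a b = ip H b a"
  by (simp add: ip_def mult.commute)

lemma ip_mult_left: "ip H (\<lambda>i. a i * b i) c = ip H a (\<lambda>i. b i * c i)"
  by (simp add: ip_def mult.assoc)

lemma ip_cong: "(\<And>i. i \<in> verts H \<Longrightarrow> a i = a' i) \<Longrightarrow> (\<And>i. i \<in> verts H \<Longrightarrow> b i = b' i) \<Longrightarrow>
    ip H a b = ip H a' b'"
  by (simp add: ip_def)

text \<open>The adjacency matrix is symmetric, hence self-adjoint.\<close>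

lemma ip_nsum: "ip H a (nsum H b) = ip H (nsum H a) b"
proof -
  have "ip H a (nsum H b) = (\<Sum>i\<in>verts H. \<Sum>j\<in>verts H. if adj H i j then a i * b j else 0)"
    by (simp add: ip_def nsum_def sum_distrib_left if_distrib cong: if_cong)
  also have "\<dots> = (\<Sum>j\<in>verts H. \<Sum>i\<in>verts H. if adj H j i then a i * b j else 0)"
    by (subst sum.swap) (simp add: adj_commute[of H])
  also have "\<dots> = ip H (nsum H a) b"
    unfolding ip_def nsum_def sum_distrib_right by (intro sum.cong) auto
  finally show ?thesis .
qed

text \<open>Changes the viewpoint across an edge: on the left \<open>f\<close> is weighed against
  everything beyond the edge, on the right \<open>w\<close> is. Thus first one part and then the
  other can be replaced by a path.\<close>

lemma ip_nsum_mult: "ip H (nsum H (\<lambda>i. a i * w i)) f = ip H (\<lambda>i. a i * nsum H f i) w"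
proof -
  have "ip H (nsum H (\<lambda>i. a i * w i)) f = ip H (\<lambda>i. a i * w i) (nsum H f)"
    by (rule ip_nsum[symmetric])
  then show ?thesis by (simp add: ip_def mult_ac)
qed

lemma ip_nsum_pow: "ip H a ((nsum H ^^ k) b) = ip H ((nsum H ^^ k) a) b"
proof (induction k arbitrary: a)
  case (Suc k)
  have "ip H a ((nsum H ^^ Suc k) b) = ip H (nsum H a) ((nsum H ^^ k) b)"
    by (simp add: ip_nsum)
  also have "\<dots> = ip H ((nsum H ^^ Suc k) a) b"
    by (simp only: Suc.IH funpow_Suc_right o_apply)
  finally show ?case .
qed simp

lemma ip_of_bool:
  assumes "finite (verts H)" "i \<in> verts H"
  shows "ip H (\<lambda>z. of_bool (z = i)) b = b i"
proof -
  have "ip H (\<lambda>z. of_bool (z = i)) b = (\<Sum>z\<in>verts H. if z = i then b z else 0)"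
    unfolding ip_def by (intro sum.cong) auto
  then show ?thesis using assms by simp
qed

section \<open>Walk numbers as entries of powers of the adjacency matrix\<close>

definition walks :: "'b ugraph \<Rightarrow> nat \<Rightarrow> 'b \<Rightarrow> 'b \<Rightarrow> nat" where
  "walks H k i j = (nsum H ^^ k) (\<lambda>x. of_bool (x = j)) i"

text \<open>The entries are inner products with unit vectors, and powers of a self-adjoint matrix
  are self-adjoint.\<close>

lemma walks_commute:
  assumes "finite (verts H)" "i \<in> verts H" "j \<in> verts H"
  shows "walks H k i j = walks H k j i"
proof -
  let ?e = "\<lambda>x z. of_bool (z = x) :: nat"
  have walks_eq: "walks H k x y = ip H (?e x) ((nsum H ^^ k) (?e y))" if "x \<in> verts H" for x y
    using assms(1) that by (simp only: walks_def ip_of_bool)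
  have "walks H k i j = ip H ((nsum H ^^ k) (?e i)) (?e j)"
    unfolding walks_eq[OF assms(2)] by (rule ip_nsum_pow)
  also have "\<dots> = walks H k j i"
    unfolding walks_eq[OF assms(3)] by (rule ip_commute)
  finally show ?thesis .
qed

lemma nsum_pow_eq_sum_walks:
  assumes "finite (verts H)" "i \<in> verts H"
  shows "(nsum H ^^ k) b i = (\<Sum>j\<in>verts H. walks H k i j * b j)"
proof -
  have "(nsum H ^^ k) b i = ip H (\<lambda>z. of_bool (z = i)) ((nsum H ^^ k) b)"
    using assms by (simp only: ip_of_bool)
  also have "\<dots> = ip H ((nsum H ^^ k) (\<lambda>z. of_bool (z = i))) b"
    by (rule ip_nsum_pow)
  also have "\<dots> = (\<Sum>j\<in>verts H. walks H k j i * b j)"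
    by (simp add: ip_def walks_def)
  also have "\<dots> = (\<Sum>j\<in>verts H. walks H k i j * b j)"
    by (intro sum.cong refl) (simp only: walks_commute[OF assms(1) _ assms(2)])
  finally show ?thesis .
qed

text \<open>The difference of the two sides is \<open>(c - a) * (d - b)\<close>, handled without
  subtraction on the naturals.\<close>

lemma nat_rearrangement:
  fixes a b c d :: nat
  assumes "a \<le> c" "b \<le> d"
  shows "a * d + c * b \<le> a * b + c * d"
    and "a < c \<Longrightarrow> b < d \<Longrightarrow> a * d + c * b < a * b + c * d"
proof -
  obtain x y where "c = a + x" "d = b + y" using assms by (auto simp: le_iff_add)
  then show "a * d + c * b \<le> a * b + c * d"
    and "a < c \<Longrightarrow> b < d \<Longrightarrow> a * d + c * b < a * b + c * d"
    by (simp_all add: algebra_simps)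
qed

text \<open>Positivity is demanded at \<open>l\<close> only, and monotonicity passes it on to all
  higher ranks. Vertices ranked below \<open>l\<close> may have entry 0, as at the isolated vertex
  of \<open>H_graph 15\<close>.\<close>

definition monotone_vec :: "'b ugraph \<Rightarrow> ('b \<Rightarrow> nat) \<Rightarrow> 'b \<Rightarrow> ('b \<Rightarrow> nat) \<Rightarrow> bool" where
  "monotone_vec H rank l a \<longleftrightarrow>
     0 < a l \<and> (\<forall>i\<in>verts H. \<forall>j\<in>verts H. rank i \<le> rank j \<longrightarrow> a i \<le> a j)"

text \<open>
  \<open>l\<close> and \<open>U\<close> witness strictness: for every \<open>k > 0\<close> some walk of length \<open>k\<close> leads from \<open>l\<close> to a vertex
  \<open>w \<in> U\<close>, and \<open>nsum H a\<close> is strictly smaller at \<open>l\<close> than at \<open>w\<close>.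
\<close>

locale ranked_target =
  fixes H :: "'b ugraph" and rank :: "'b \<Rightarrow> nat" and l :: 'b and U :: "'b set"
  assumes finite_verts: "finite (verts H)"
    and low: "l \<in> verts H" and up: "U \<subseteq> verts H"
    and low_nbr: "\<exists>u\<in>U. adj H l u"
    and up_nbr: "u \<in> U \<Longrightarrow> \<exists>w\<in>U. adj H u w"
    and nsum_mon: "monotone_vec H rank l a \<Longrightarrow> monotone_vec H rank l (nsum H a)"
    and nsum_strict: "monotone_vec H rank l a \<Longrightarrow> u \<in> U \<Longrightarrow> nsum H a l < nsum H a u"
begin

abbreviation mon :: "('b \<Rightarrow> nat) \<Rightarrow> bool" where
  "mon \<equiv> monotone_vec H rank l"

definition strict :: "('b \<Rightarrow> nat) \<Rightarrow> bool" where
  "strict a \<longleftrightarrow> mon a \<and> (\<forall>u\<in>U. a l < a u)"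

lemma strict_nsum: "mon a \<Longrightarrow> strict (nsum H a)"
  by (simp add: strict_def nsum_mon nsum_strict)

lemma strict_mon: "strict a \<Longrightarrow> mon a"
  by (simp add: strict_def)

lemma mon_one: "mon (\<lambda>_. 1)"
  by (simp add: monotone_vec_def)

lemma mon_mult: "mon a \<Longrightarrow> mon b \<Longrightarrow> mon (\<lambda>i. a i * b i)"
  by (auto simp: monotone_vec_def intro: mult_mono)

lemma mon_cong: "(\<And>i. i \<in> verts H \<Longrightarrow> a i = b i) \<Longrightarrow> mon a \<longleftrightarrow> mon b"
  by (simp add: monotone_vec_def low)

lemma mon_walks_from: "mon (walks_from H k)"
  by (induction k) (use mon_one nsum_mon in auto)

lemma strict_walks_from: "0 < k \<Longrightarrow> strict (walks_from H k)"
  using strict_nsum[OF mon_walks_from] by (cases k) auto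

text \<open>Root vectors are built from the constant 1 by \<open>nsum\<close> and entrywise
  products, and both operations preserve monotonicity.\<close>

lemma mon_root_count:
  assumes "tree T" "r \<in> verts T"
  shows "mon (root_count T H r)"
  using assms
proof (induction rule: tree_induct)
  case (single T r)
  then have "root_count T H r i = 1" if "i \<in> verts H" for i
    using tree_irrefl that by (intro root_count_single)
  then show ?case using mon_one mon_cong[of "root_count T H r" "\<lambda>_. 1"] by blast
next
  case (join T T1 s T2 r)
  have "root_count T H r = (\<lambda>i. nsum H (root_count T1 H s) i * root_count T2 H r i)"
    using root_count_join[OF join(3) finite_verts] by blast
  then show ?case using join by (simp add: mon_mult nsum_mon)
qed

text \<open>Every vertex of \<open>U\<close> has a neighbour in \<open>U\<close>, so a walk can stay
  in \<open>U\<close> for any number of steps.\<close>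

lemma walks_up:
  assumes "u \<in> U"
  shows "\<exists>w\<in>U. 0 < walks H k u w"
  using assms
proof (induction k arbitrary: u)
  case 0
  then show ?case by (auto simp: walks_def)
next
  case (Suc k)
  obtain v where v: "v \<in> U" "adj H u v" using up_nbr Suc.prems by blast
  then obtain w where w: "w \<in> U" "0 < walks H k v w" using Suc.IH by blast
  then have "0 < walks H (Suc k) u w"
    using v up finite_verts by (auto simp: walks_def nsum_def sum_pos2[of _ v])
  with w show ?case by blast
qed

lemma walks_low:
  assumes "0 < k"
  shows "\<exists>w\<in>U. 0 < walks H k l w"
proof -
  obtain m where k: "k = Suc m" using assms by (cases k) auto
  obtain v where v: "v \<in> U" "adj H l v" using low_nbr by blast
  then obtain w where w: "w \<in> U" "0 < walks H m v w" using walks_up by blast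
  then have "0 < walks H k l w"
    using v up finite_verts by (auto simp: k walks_def nsum_def sum_pos2[of _ v])
  with w show ?thesis by blast
qed

text \<open>
  Moving a branch \<open>b\<close> from one end of a path with \<open>k\<close> edges to its other end, where \<open>a\<close> is
  attached. With \<open>W\<close> the symmetric matrix of walk numbers, twice the change is
  \<open>\<Sum>i j. W i j * (a i - a j) * (b i - b j)\<close>, and similarly ordered vectors make every summand
  nonnegative.
\<close>

lemma branch_shift:
  assumes a: "mon a" and b: "mon b"
  shows "ip H a ((nsum H ^^ k) b) \<le> ip H (\<lambda>i. a i * b i) (walks_from H k)" (is "?X \<le> ?Y")
    and "strict a \<Longrightarrow> strict b \<Longrightarrow> 0 < k \<Longrightarrow>
      ip H a ((nsum H ^^ k) b) < ip H (\<lambda>i. a i * b i) (walks_from H k)"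
proof -
  let ?V = "verts H" and ?W = "walks H k"
  \<comment> \<open>Symmetrised summands: adding the double sum to its transpose turns the
    comparison of the doubled sides into one for each pair \<open>i\<close>,
    \<open>j\<close>.\<close>
  define x y where "x i j = ?W i j * (a i * b j + a j * b i)"
    and "y i j = ?W i j * (a i * b i + a j * b j)" for i j
  have X: "?X = (\<Sum>i\<in>?V. \<Sum>j\<in>?V. ?W i j * (a i * b j))"
    using finite_verts by (simp add: ip_def nsum_pow_eq_sum_walks sum_distrib_left mult_ac)
  have Y: "?Y = (\<Sum>i\<in>?V. \<Sum>j\<in>?V. ?W i j * (a i * b i))"
    using finite_verts by (simp add: ip_def nsum_pow_eq_sum_walks sum_distrib_left mult_ac)
  have swap: "(\<Sum>i\<in>?V. \<Sum>j\<in>?V. ?W i j * f i j) = (\<Sum>i\<in>?V. \<Sum>j\<in>?V. ?W i j * f j i)" for f :: "'b \<Rightarrow> 'b \<Rightarrow> nat"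
    using walks_commute[OF finite_verts] by (subst sum.swap) (simp cong: sum.cong)
  have X2: "2 * ?X = (\<Sum>i\<in>?V. \<Sum>j\<in>?V. x i j)"
    using swap[of "\<lambda>i j. a i * b j"] by (simp add: X x_def distrib_left sum.distrib)
  have Y2: "2 * ?Y = (\<Sum>i\<in>?V. \<Sum>j\<in>?V. y i j)"
    unfolding Y y_def using swap[of "\<lambda>i j. a i * b i"] by (simp add: distrib_left sum.distrib mult_2)
  have xy: "x i j \<le> y i j" if "i \<in> ?V" "j \<in> ?V" for i j
  proof (cases "rank i \<le> rank j")
    case True
    then have "a i \<le> a j" "b i \<le> b j" using a b that by (auto simp: monotone_vec_def)
    from nat_rearrangement(1)[OF this] show ?thesis by (simp add: x_def y_def)
  next
    case False
    then have "a j \<le> a i" "b j \<le> b i" using a b that by (auto simp: monotone_vec_def)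
    from nat_rearrangement(1)[OF this] show ?thesis by (simp add: x_def y_def add.commute)
  qed
  then have "2 * ?X \<le> 2 * ?Y"
    unfolding X2 Y2 by (intro sum_mono)
  then show "?X \<le> ?Y" by simp
  assume st: "strict a" "strict b" and k: "0 < k"
  \<comment> \<open>One pair with a positive walk number at which both vectors differ strictly makes
    the whole sum strict.\<close>
  obtain w where w: "w \<in> U" "0 < ?W l w" using walks_low k by blast
  then have wV: "w \<in> ?V" using up by blast
  have "a l < a w" "b l < b w" using st w by (auto simp: strict_def)
  then have "x l w < y l w"
    using w nat_rearrangement(2)[of "a l" "a w" "b l" "b w"] by (simp add: x_def y_def)
  then have "(\<Sum>j\<in>?V. x l j) < (\<Sum>j\<in>?V. y l j)"
    using xy low wV finite_verts by (intro sum_strict_mono_ex1) auto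
  then have "2 * ?X < 2 * ?Y"
    unfolding X2 Y2 using xy low finite_verts by (intro sum_strict_mono_ex1 ballI sum_mono) auto
  then show "?X < ?Y" by simp
qed

text \<open>The weight \<open>a\<close> stands for whatever else hangs from \<open>r\<close>; it
  must be arbitrary because each part sees the rest of the tree as its weight. Starting from a
  single path, its final segment \<open>?w2\<close> is shifted to \<open>r\<close> by
  \<open>branch_shift\<close>, then the induction hypotheses replace \<open>?w1\<close> by the
  branch \<open>T1\<close> and \<open>?w2\<close> by \<open>T2\<close>.\<close>

lemma attach_path_le:
  assumes "tree T" "r \<in> verts T" "mon a"
  shows "ip H a (walks_from H (card (verts T) - 1)) \<le> ip H a (root_count T H r)"
  using assms
proof (induction arbitrary: a rule: tree_induct)
  case (single T r)
  have "ip H a (root_count T H r) = ip H a (\<lambda>_. 1)"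
    using single(2) tree_irrefl[OF single(1)] by (intro ip_cong root_count_single) auto
  then show ?case using single by simp
next
  case (join T T1 s T2 r)
  obtain m1 m2 where m: "card (verts T1) = Suc m1" "card (verts T2) = Suc m2"
    using edge_join_card[OF join(3)] by (metis gr0_implies_Suc)
  let ?f1 = "root_count T1 H s" and ?f2 = "root_count T2 H r"
  let ?w1 = "walks_from H m1" and ?w2 = "walks_from H m2"
  have mon1: "mon (nsum H ?f1)"
    using join(1,3) by (auto simp: edge_join_def intro: nsum_mon mon_root_count)
  have "ip H a (walks_from H (card (verts T) - 1)) = ip H a ((nsum H ^^ Suc m1) ?w2)"
    using edge_join_card(1)[OF join(3)] m by (simp add: funpow_add)
  also have "\<dots> \<le> ip H (\<lambda>i. a i * ?w2 i) (nsum H ?w1)"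
    using branch_shift(1)[OF join.prems mon_walks_from, of "Suc m1"] by simp
  also have "\<dots> = ip H (nsum H (\<lambda>i. a i * ?w2 i)) ?w1"
    by (rule ip_nsum)
  also have "\<dots> \<le> ip H (nsum H (\<lambda>i. a i * ?w2 i)) ?f1"
    using join.IH(1)[of "nsum H (\<lambda>i. a i * ?w2 i)"] join.prems m mon_walks_from
    by (simp add: nsum_mon mon_mult)
  also have "\<dots> = ip H (\<lambda>i. a i * nsum H ?f1 i) ?w2"
    by (rule ip_nsum_mult)
  also have "\<dots> \<le> ip H (\<lambda>i. a i * nsum H ?f1 i) ?f2"
    using join.IH(2)[of "\<lambda>i. a i * nsum H ?f1 i"] join.prems m mon1 by (simp add: mon_mult)
  also have "\<dots> = ip H a (root_count T H r)"
    using root_count_join[OF join(3) finite_verts] by (simp add: ip_mult_left ip_def)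
  finally show ?case .
qed

text \<open>In the equality case every inequality of \<open>attach_path_le\<close> is tight.
  Strictness of the shift then forces \<open>T2\<close> to be the single vertex \<open>r\<close>,
  and tightness is inherited by \<open>T1\<close>, so \<open>r\<close> extends a path at its
  end.\<close>

lemma attach_path_eq:
  assumes "tree T" "r \<in> verts T" "strict a"
    and "ip H a (root_count T H r) \<le> ip H a (walks_from H (card (verts T) - 1))"
  shows "end_path T r"
  using assms
proof (induction arbitrary: a rule: tree_induct)
  case (single T r)
  then show ?case using tree_irrefl by (intro end_path_single)
next
  case (join T T1 s T2 r)
  note J = join(3)
  obtain m1 m2 where m: "card (verts T1) = Suc m1" "card (verts T2) = Suc m2"
    using edge_join_card[OF J] by (metis gr0_implies_Suc)
  let ?f1 = "root_count T1 H s" and ?f2 = "root_count T2 H r"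
  let ?w1 = "walks_from H m1" and ?w2 = "walks_from H m2"
  note mona = strict_mon[OF join.prems(1)]
  have sr: "s \<in> verts T1" "r \<in> verts T2" using J by (auto simp: edge_join_def)
  have mon1: "mon (nsum H ?f1)" using join(1) sr by (intro nsum_mon mon_root_count)
  have A: "ip H (nsum H (\<lambda>i. a i * ?w2 i)) ?f1 \<le> ip H a (root_count T H r)"
  proof -
    have "ip H (nsum H (\<lambda>i. a i * ?w2 i)) ?f1 = ip H (\<lambda>i. a i * nsum H ?f1 i) ?w2"
      by (rule ip_nsum_mult)
    also have "\<dots> \<le> ip H (\<lambda>i. a i * nsum H ?f1 i) ?f2"
      using attach_path_le[OF join(2) sr(2), of "\<lambda>i. a i * nsum H ?f1 i"] mona m mon1
      by (simp add: mon_mult)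
    also have "\<dots> = ip H a (root_count T H r)"
      using root_count_join[OF J finite_verts] by (simp add: ip_mult_left ip_def)
    finally show ?thesis .
  qed
  have B: "ip H a (walks_from H (card (verts T) - 1)) = ip H a ((nsum H ^^ Suc m1) ?w2)"
    using edge_join_card(1)[OF J] m by (simp add: funpow_add)
  have C: "ip H (nsum H (\<lambda>i. a i * ?w2 i)) ?w1 = ip H (\<lambda>i. a i * ?w2 i) (walks_from H (Suc m1))"
    by (simp add: ip_nsum)
  have D: "ip H (nsum H (\<lambda>i. a i * ?w2 i)) ?w1 \<le> ip H (nsum H (\<lambda>i. a i * ?w2 i)) ?f1"
    using attach_path_le[OF join(1) sr(1), of "nsum H (\<lambda>i. a i * ?w2 i)"] mona m mon_walks_from
    by (simp add: nsum_mon mon_mult)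
  \<comment> \<open>If \<open>T2\<close> had an edge, \<open>?w2\<close> would be strict like
    \<open>a\<close>, and shifting it over \<open>Suc m1 > 0\<close> edges would change the count
    strictly.\<close>
  have "m2 = 0"
  proof (rule ccontr)
    assume "m2 \<noteq> 0"
    then have "ip H a ((nsum H ^^ Suc m1) ?w2) < ip H (\<lambda>i. a i * ?w2 i) (walks_from H (Suc m1))"
      using join.prems(1) mona
      by (intro branch_shift(2) mon_walks_from strict_walks_from) auto
    then show False using join.prems(2) A B C D by linarith
  qed
  then have T2: "verts T2 = {r}" using m sr by (auto simp: card_1_singleton_iff)
  have "ip H (nsum H (\<lambda>i. a i * ?w2 i)) ?f1 \<le> ip H (nsum H (\<lambda>i. a i * ?w2 i)) ?w1"
    using branch_shift(1)[OF mona mon_walks_from, of "Suc m1" m2] join.prems(2) A B C by linarith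
  \<comment> \<open>The induction hypothesis needs a strict weight; this one is strict because it is
    the image of a monotone vector under \<open>nsum\<close>.\<close>
  then have "end_path T1 s"
    using join.IH(1)[of "nsum H (\<lambda>i. a i * ?w2 i)"] mona m mon_walks_from
    by (simp add: strict_nsum mon_mult)
  moreover have "end_path T2 r" using T2 join(2) tree_irrefl by (intro end_path_single)
  ultimately obtain \<phi> where "bij_betw \<phi> (verts T) {1..card (verts T)}" "\<phi> r = Suc (card (verts T1))"
    "\<forall>u\<in>verts T. \<forall>v\<in>verts T. adj T u v \<longleftrightarrow> \<phi> u = Suc (\<phi> v) \<or> \<phi> v = Suc (\<phi> u)"
    using end_path_join[OF J] by blast
  moreover have "card (verts T) = Suc (card (verts T1))"
    using edge_join_card(1)[OF J] T2 by simp
  ultimately show ?case unfolding end_path_def by auto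
qed

section \<open>From weighted rooted trees to plain counts\<close>

lemma hom_tree_eq_ip:
  assumes "tree T" "r \<in> verts T"
  shows "hom T H = ip H (\<lambda>_. 1) (root_count T H r)"
  using hom_eq_sum_root_count[OF loop_graph_finite[OF tree_loop_graph[OF assms(1)]] finite_verts assms(2)]
  by (simp add: ip_def)

lemma hom_path_graph_eq_ip:
  "1 \<le> n \<Longrightarrow> hom (path_graph n) H = ip H (\<lambda>_. 1) (walks_from H (n - 1))"
  using finite_verts by (simp add: hom_path_graph ip_def)

lemma hom_path_graph_le:
  assumes "tree T"
  shows "hom (path_graph (card (verts T))) H \<le> hom T H"
proof -
  obtain r where r: "r \<in> verts T" using assms by (auto simp: tree_def connected_graph_def)
  then have "1 \<le> card (verts T)"
    using loop_graph_finite[OF tree_loop_graph[OF assms]] by (auto simp: Suc_le_eq card_gt_0_iff)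
  then show ?thesis
    using attach_path_le[OF assms r mon_one] hom_tree_eq_ip[OF assms r] hom_path_graph_eq_ip by simp
qed

text \<open>The constant weight 1 is not strict, so \<open>attach_path_eq\<close> does not apply at
  the root itself. Cut at an edge instead: each part sees the other side as a strict weight, so both
  parts are paths ending at the cut edge.\<close>

lemma iso_path_graph_if_hom_le:
  assumes T: "tree T" and n: "2 \<le> card (verts T)"
    and le: "hom T H \<le> hom (path_graph (card (verts T))) H"
  shows "graph_iso T (path_graph (card (verts T)))"
proof -
  obtain r where r: "r \<in> verts T" using T by (auto simp: tree_def connected_graph_def)
  have "verts T \<noteq> {r}" using n by auto
  then obtain T1 s T2 where trees: "tree T1" "tree T2" and J: "edge_join T T1 s T2 r"
    using tree_split[OF T r] by blast
  obtain m1 m2 where m: "card (verts T1) = Suc m1" "card (verts T2) = Suc m2"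
    using edge_join_card[OF J] by (metis gr0_implies_Suc)
  let ?f1 = "root_count T1 H s" and ?f2 = "root_count T2 H r"
  let ?w1 = "walks_from H m1" and ?w2 = "walks_from H m2"
  have sr: "s \<in> verts T1" "r \<in> verts T2" using J by (auto simp: edge_join_def)
  have strict1: "strict (nsum H ?f1)" using trees(1) sr(1) by (intro strict_nsum mon_root_count)
  have strict2: "strict (walks_from H (Suc m2))" by (rule strict_walks_from) simp
  \<comment> \<open>Facts A to E form the chain from \<open>hom T H\<close> down to the path,
    replacing first \<open>?f2\<close> by \<open>?w2\<close> and then \<open>?f1\<close> by
    \<open>?w1\<close>; the assumption \<open>le\<close> makes both replacements equalities.\<close>
  have A: "hom T H = ip H (nsum H ?f1) ?f2"
    using hom_tree_eq_ip[OF T r] root_count_join[OF J finite_verts] by (simp add: ip_def)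
  have B: "ip H (nsum H ?f1) ?w2 \<le> ip H (nsum H ?f1) ?f2"
    using attach_path_le[OF trees(2) sr(2) strict_mon[OF strict1]] m by simp
  have C: "ip H (nsum H ?f1) ?w2 = ip H (walks_from H (Suc m2)) ?f1"
    by (simp add: ip_nsum[symmetric] ip_commute[of H ?f1])
  have D: "ip H (walks_from H (Suc m2)) ?w1 \<le> ip H (walks_from H (Suc m2)) ?f1"
    using attach_path_le[OF trees(1) sr(1) strict_mon[OF strict2]] m by simp
  have E: "ip H (walks_from H (Suc m2)) ?w1 = hom (path_graph (card (verts T))) H"
  proof -
    have "card (verts T) - 1 = Suc m2 + m1" using edge_join_card(1)[OF J] m by simp
    then have "hom (path_graph (card (verts T))) H = ip H (\<lambda>_. 1) (walks_from H (Suc m2 + m1))"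
      using n by (subst hom_path_graph_eq_ip) auto
    also have "\<dots> = ip H (\<lambda>_. 1) ((nsum H ^^ Suc m2) ?w1)"
      by (simp only: funpow_add o_apply)
    also have "\<dots> = ip H (walks_from H (Suc m2)) ?w1"
      by (rule ip_nsum_pow)
    finally show ?thesis ..
  qed
  have "end_path T2 r"
    using A B C D E le m by (intro attach_path_eq[OF trees(2) sr(2) strict1]) simp
  moreover have "end_path T1 s"
    using A B C D E le m by (intro attach_path_eq[OF trees(1) sr(1) strict2]) simp
  ultimately show ?thesis
    using end_path_join[OF J] iso_path_graphI by metis
qed

end

subsection \<open>Targets whose degree is constant on components\<close>

text \<open>All colours reachable from \<open>i\<close> have the degree of \<open>i\<close>, so
  extending a coloring along each edge of \<open>T\<close> offers that many choices, whatever the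
  shape of \<open>T\<close>.\<close>

lemma root_count_locally_regular:
  assumes "tree T" "r \<in> verts T" and fin: "finite (verts H)" and i: "i \<in> verts H"
    and reg: "\<And>i j. i \<in> verts H \<Longrightarrow> j \<in> verts H \<Longrightarrow> adj H i j \<Longrightarrow>
      nsum H (\<lambda>_. 1) i = nsum H (\<lambda>_. 1) j"
  shows "root_count T H r i = nsum H (\<lambda>_. 1) i ^ (card (verts T) - 1)"
  using assms(1,2) i
proof (induction arbitrary: i rule: tree_induct)
  case (single T r)
  have "root_count T H r i = 1"
    using single(2,3) tree_irrefl[OF single(1)] by (intro root_count_single)
  then show ?case using single by simp
next
  case (join T T1 s T2 r)
  let ?d = "nsum H (\<lambda>_. 1)"
  obtain m1 m2 where m: "card (verts T1) = Suc m1" "card (verts T2) = Suc m2"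
    using edge_join_card[OF join(3)] by (metis gr0_implies_Suc)
  have "nsum H (root_count T1 H s) i = (\<Sum>j\<in>verts H. if adj H i j then ?d i ^ m1 else 0)"
    unfolding nsum_def[of H "root_count T1 H s"]
  proof (intro sum.cong refl if_cong)
    fix j assume "j \<in> verts H" "adj H i j"
    then show "root_count T1 H s j = ?d i ^ m1"
      using join.IH(1) reg[OF join.prems] m by simp
  qed
  also have "\<dots> = ?d i * ?d i ^ m1"
    unfolding nsum_def[of H "\<lambda>_. 1"] sum_distrib_right by (intro sum.cong) auto
  finally show ?case
    using root_count_join[OF join(3) fin, of i] join.IH(2)[OF join.prems] m
      edge_join_card(1)[OF join(3)] by (simp add: power_add)
qed

lemma hom_locally_regular:
  assumes T: "tree T" and fin: "finite (verts H)"
    and reg: "\<And>i j. i \<in> verts H \<Longrightarrow> j \<in> verts H \<Longrightarrow> adj H i j \<Longrightarrow>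
      nsum H (\<lambda>_. 1) i = nsum H (\<lambda>_. 1) j"
  shows "hom T H = (\<Sum>i\<in>verts H. nsum H (\<lambda>_. 1) i ^ (card (verts T) - 1))"
proof -
  obtain r where r: "r \<in> verts T" using T by (auto simp: tree_def connected_graph_def)
  then show ?thesis
    using hom_eq_sum_root_count[OF loop_graph_finite[OF tree_loop_graph[OF T]] fin r]
      root_count_locally_regular[OF T r fin _ reg] by simp
qed

subsection \<open>Bipartitions and the target \<open>H\<^sub>1\<^sub>9\<close>\<close>

lemma bipartition_exists:
  assumes "tree T" "r \<in> verts T"
  shows "\<exists>X Y. bipartition T X Y \<and> r \<in> X"
  using assms
proof (induction rule: tree_induct)
  case (single T r)
  have "\<not> adj T u v" for u v
    using adj_in_verts[OF tree_loop_graph[OF single(1)]] tree_irrefl[OF single(1)] single(2)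
    by (metis singletonD)
  with single(2) have "bipartition T {r} {}" by (auto simp: bipartition_def)
  then show ?case by blast
next
  case (join T T1 s T2 r)
  then obtain X1 Y1 X2 Y2 where "bipartition T1 X1 Y1" "s \<in> X1" "bipartition T2 X2 Y2" "r \<in> X2"
    by blast
  note b = this
  \<comment> \<open>The classes are merged crosswise, since the joining edge has to lead from the
    class of \<open>s\<close> to the class of \<open>r\<close>.\<close>
  have "bipartition T (Y1 \<union> X2) (X1 \<union> Y2)"
    unfolding bipartition_def
  proof (intro conjI allI impI)
    show "(Y1 \<union> X2) \<union> (X1 \<union> Y2) = verts T" "(Y1 \<union> X2) \<inter> (X1 \<union> Y2) = {}"
      using b join(3) by (auto simp: bipartition_def edge_join_def)
    fix u v assume "adj T u v"
    then consider "adj T1 u v" | "adj T2 u v" | "u = s \<and> v = r \<or> u = r \<and> v = s"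
      using join(3) by (auto simp: edge_join_def)
    then show "u \<in> Y1 \<union> X2 \<and> v \<in> X1 \<union> Y2 \<or> u \<in> X1 \<union> Y2 \<and> v \<in> Y1 \<union> X2"
      by cases (use b in \<open>auto simp: bipartition_def\<close>)
  qed
  with b show ?case by blast
qed

lemma bipartition_commute: "bipartition G X Y \<Longrightarrow> bipartition G Y X"
  unfolding bipartition_def by blast

lemma bipartition_subgraph:
  assumes bip: "bipartition G X Y" and S: "loop_graph S" and "verts S \<subseteq> verts G"
    and "\<And>u v. adj S u v \<Longrightarrow> adj G u v"
  shows "bipartition S (X \<inter> verts S) (Y \<inter> verts S)"
proof -
  have "(u \<in> X \<inter> verts S \<and> v \<in> Y \<inter> verts S) \<or> (u \<in> Y \<inter> verts S \<and> v \<in> X \<inter> verts S)"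
    if "adj S u v" for u v
  proof -
    have "(u \<in> X \<and> v \<in> Y) \<or> (u \<in> Y \<and> v \<in> X)"
      using bip assms(4)[OF that] by (simp add: bipartition_def)
    then show ?thesis using adj_in_verts[OF S that] by blast
  qed
  moreover have "X \<inter> verts S \<union> Y \<inter> verts S = verts S" "(X \<inter> verts S) \<inter> (Y \<inter> verts S) = {}"
    using bip assms(3) by (auto simp: bipartition_def)
  ultimately show ?thesis by (simp add: bipartition_def)
qed

lemma bipartition_card:
  assumes "bipartition G X Y" "finite (verts G)"
  shows "finite X" "finite Y" "card X + card Y = card (verts G)"
proof -
  have "verts G = X \<union> Y" "X \<inter> Y = {}" using assms by (auto simp: bipartition_def)
  then show "finite X" "finite Y" "card X + card Y = card (verts G)"
    using assms(2) by (auto simp: card_Un_disjoint)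
qed

lemma atLeastAtMost_small: "{Suc 0..Suc 0} = {1}" "{Suc 0..2} = {1, 2}" "{Suc 0..3} = {1, 2, 3}"
  by auto

lemmas H_graph_simps = H_graph_def H_table_def atLeastAtMost_small

lemmas adj_H_simps = adj_def H_graph_simps doubleton_eq_iff

lemma verts_H19: "verts (H_graph 19) = {1, 2, 3}"
  by (simp add: H_graph_simps)

text \<open>The target is the path 1-2-3. One class of \<open>T\<close> is coloured 2 throughout and
  the vertices of the other choose freely between 1 and 3; for root colours 1 and 3 the choice at
  the root is already made.\<close>

lemma root_count_H19:
  assumes "tree T" "r \<in> verts T" "bipartition T X Y" "r \<in> X"
  shows "root_count T (H_graph 19) r 1 = 2 ^ (card X - 1) \<and>
    root_count T (H_graph 19) r 2 = 2 ^ card Y \<and>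
    root_count T (H_graph 19) r 3 = 2 ^ (card X - 1)"
  using assms
proof (induction arbitrary: X Y rule: tree_induct)
  case (single T r)
  have "root_count T (H_graph 19) r i = 1" if "i \<in> {1, 2, 3}" for i
    using single(2) tree_irrefl[OF single(1)] that
    by (intro root_count_single) (simp_all add: verts_H19)
  moreover have "X = {r}" "Y = {}" using single by (auto simp: bipartition_def)
  ultimately show ?case by simp
next
  case (join T T1 s T2 r)
  let ?H = "H_graph 19" and ?V1 = "verts T1" and ?V2 = "verts T2"
  have V: "verts T = ?V1 \<union> ?V2" "?V1 \<inter> ?V2 = {}" "s \<in> ?V1" "r \<in> ?V2"
    and lg: "loop_graph T1" "loop_graph T2"
    and adj: "\<And>u v. adj T u v \<longleftrightarrow> adj T1 u v \<or> adj T2 u v \<or> (u = s \<and> v = r) \<or> (u = r \<and> v = s)"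
    using join(3) by (auto simp: edge_join_def)
  have XY: "X \<union> Y = verts T" "X \<inter> Y = {}"
    and bip: "\<And>u v. adj T u v \<Longrightarrow> (u \<in> X \<and> v \<in> Y) \<or> (u \<in> Y \<and> v \<in> X)"
    using join.prems by (auto simp: bipartition_def)
  have sY: "s \<in> Y" using bip[of r s] adj join.prems(2) XY(2) by blast
  \<comment> \<open>The root \<open>s\<close> of the branch lies in \<open>Y\<close>, so the two
    classes exchange roles in \<open>T1\<close>.\<close>
  have b1: "bipartition T1 (Y \<inter> ?V1) (X \<inter> ?V1)"
    using bipartition_subgraph[OF bipartition_commute[OF join.prems(1)] lg(1)] V(1) adj by blast
  have b2: "bipartition T2 (X \<inter> ?V2) (Y \<inter> ?V2)"
    using bipartition_subgraph[OF join.prems(1) lg(2)] V(1) adj by blast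
  note IH1 = join.IH(1)[OF b1] and IH2 = join.IH(2)[OF b2]
  have fin: "finite ?V1" "finite ?V2" using lg by (simp_all add: loop_graph_finite)
  have split: "card A = card (A \<inter> ?V1) + card (A \<inter> ?V2)" if "A \<subseteq> verts T" for A
  proof -
    have "A = (A \<inter> ?V1) \<union> (A \<inter> ?V2)" using that V(1) by blast
    moreover have "card ((A \<inter> ?V1) \<union> (A \<inter> ?V2)) = card (A \<inter> ?V1) + card (A \<inter> ?V2)"
      using V(2) fin by (intro card_Un_disjoint) auto
    ultimately show ?thesis by simp
  qed
  have cX: "card X = card (X \<inter> ?V1) + card (X \<inter> ?V2)" by (rule split) (use XY in auto)
  have cY: "card Y = card (Y \<inter> ?V1) + card (Y \<inter> ?V2)" by (rule split) (use XY in auto)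
  have pos: "0 < card (X \<inter> ?V2)" "0 < card (Y \<inter> ?V1)"
    using fin join.prems(2) sY V by (auto simp: card_gt_0_iff)
  have nsum: "nsum ?H a (Suc 0) = a 2" "nsum ?H a 2 = a 1 + a 3" "nsum ?H a 3 = a 2" for a
    by (simp_all add: nsum_def adj_H_simps)
  have fH: "finite (verts ?H)" by (simp add: verts_H19)
  note rc = root_count_join[OF join(3) fH]
  obtain p where p: "card (X \<inter> ?V2) = Suc p" using pos by (metis gr0_implies_Suc)
  obtain q where q: "card (Y \<inter> ?V1) = Suc q" using pos by (metis gr0_implies_Suc)
  show ?case
    using IH1 IH2 sY V join.prems(2) cX cY p q by (simp add: rc nsum power_add)
qed

lemma hom_H19:
  assumes T: "tree T" and bip: "bipartition T X Y"
  shows "hom T (H_graph 19) = 2 ^ card X + 2 ^ card Y"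
proof -
  obtain r where r: "r \<in> verts T" using T by (auto simp: tree_def connected_graph_def)
  note finT = loop_graph_finite[OF tree_loop_graph[OF T]]
  have *: "hom T (H_graph 19) = 2 ^ card X + 2 ^ card Y" if bip: "bipartition T X Y" and "r \<in> X" for X Y
  proof -
    have "0 < card X" using bipartition_card(1)[OF bip finT] that(2) by (auto simp: card_gt_0_iff)
    \<comment> \<open>The entries for root colours 1 and 3 add up to a full power; this needs
      \<open>X\<close> nonempty because subtraction truncates.\<close>
    then have "2 ^ card X = (2::nat) * 2 ^ (card X - 1)"
      by (metis Suc_pred' power_Suc)
    then show ?thesis
      using root_count_H19[OF T r that] hom_eq_sum_root_count[OF finT _ r, of "H_graph 19"]
      by (simp add: verts_H19)
  qed
  have "r \<in> X \<or> r \<in> Y" using bip r by (auto simp: bipartition_def)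
  then show ?thesis
  proof
    assume "r \<in> Y"
    from *[OF bipartition_commute[OF bip] this] show ?thesis by simp
  qed (rule *[OF bip])
qed

text \<open>Balanced means that neither part exceeds the upper half of \<open>n\<close>. A larger
  part alone contributes at least twice the larger power in \<open>c\<close>, which is already
  \<open>c\<close> or more.\<close>

lemma two_powers_balanced_le:
  fixes a b n :: nat
  assumes "a + b = n"
  defines "c \<equiv> 2 ^ (n div 2) + 2 ^ (n - n div 2)"
  shows "(c::nat) \<le> 2 ^ a + 2 ^ b"
    and "2 ^ a + 2 ^ b = c \<longleftrightarrow> (if even n then a = b else \<bar>int a - int b\<bar> = 1)"
proof -
  let ?m = "n div 2" and ?M = "n - n div 2"
  have bal: "(if even n then a = b else \<bar>int a - int b\<bar> = 1) \<longleftrightarrow> a \<le> ?M \<and> b \<le> ?M"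
  proof (cases "even n")
    case True
    then obtain k where "n = 2 * k" by (elim evenE)
    then show ?thesis using assms(1) by auto
  next
    case False
    then obtain k where k: "n = 2 * k + 1" by (elim oddE)
    then have "?M = k + 1" by simp
    moreover have "\<bar>int a - int b\<bar> = 1 \<longleftrightarrow> a \<le> k + 1 \<and> b \<le> k + 1"
      using k assms(1) by arith
    ultimately show ?thesis using False by simp
  qed
  have mM: "?m + ?M = n" "?m \<le> ?M" "?M \<le> Suc ?m" by linarith+
  have "c \<le> 2 ^ a + 2 ^ b \<and> (2 ^ a + 2 ^ b = c \<longleftrightarrow> a \<le> ?M \<and> b \<le> ?M)"
  proof (cases "a \<le> ?M \<and> b \<le> ?M")
    case True
    then have "a = ?m \<and> b = ?M \<or> a = ?M \<and> b = ?m"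
      using assms(1) mM by (cases "a = ?M") linarith+
    then show ?thesis using True by (auto simp: c_def)
  next
    case False
    have gt: "c < 2 ^ x + 2 ^ y" if "?M < x" for x y :: nat
    proof -
      have "(2::nat) ^ ?m \<le> 2 ^ ?M" by (intro power_increasing) auto
      moreover have "(2::nat) ^ Suc ?M \<le> 2 ^ x" using that by (intro power_increasing) auto
      moreover have "(0::nat) < 2 ^ y" by simp
      ultimately show ?thesis unfolding c_def power_Suc by linarith
    qed
    from False have "c < 2 ^ a + 2 ^ b" using gt[of a b] gt[of b a] by auto
    with False show ?thesis by simp
  qed
  with bal show "c \<le> 2 ^ a + 2 ^ b"
    and "2 ^ a + 2 ^ b = c \<longleftrightarrow> (if even n then a = b else \<bar>int a - int b\<bar> = 1)" by auto
qed

lemma hom_H19_balanced: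
  assumes T: "tree T" and n: "card (verts T) = n"
  shows "2 ^ (n div 2) + 2 ^ (n - n div 2) \<le> hom T (H_graph 19)"
    and "hom T (H_graph 19) = 2 ^ (n div 2) + 2 ^ (n - n div 2) \<longleftrightarrow> has_balanced_bipartition T"
proof -
  note finT = loop_graph_finite[OF tree_loop_graph[OF T]]
  \<comment> \<open>Stated for every bipartition: \<open>has_balanced_bipartition\<close> only
    promises some bipartition, while the value of \<open>hom\<close> is the same for all.\<close>
  have *: "2 ^ (n div 2) + 2 ^ (n - n div 2) \<le> hom T (H_graph 19) \<and>
    (hom T (H_graph 19) = 2 ^ (n div 2) + 2 ^ (n - n div 2) \<longleftrightarrow>
      (if even (card (verts T)) then card X = card Y else \<bar>int (card X) - int (card Y)\<bar> = 1))"
    if "bipartition T X Y" for X Y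
    using two_powers_balanced_le[of "card X" "card Y" n] bipartition_card(3)[OF that finT] n
      hom_H19[OF T that] by simp
  obtain r where "r \<in> verts T" using T by (auto simp: tree_def connected_graph_def)
  then obtain X Y where bip: "bipartition T X Y" using bipartition_exists[OF T] by blast
  show "2 ^ (n div 2) + 2 ^ (n - n div 2) \<le> hom T (H_graph 19)"
    using *[OF bip] by blast
  show "hom T (H_graph 19) = 2 ^ (n div 2) + 2 ^ (n - n div 2) \<longleftrightarrow> has_balanced_bipartition T"
    unfolding has_balanced_bipartition_def using *[OF bip] * bip by blast
qed

lemma card_even_upto: "card {i \<in> {1..n::nat}. even i} = n div 2"
proof (induction n)
  case (Suc n)
  have "{i \<in> {1..Suc n}. even i} =
      (if even (Suc n) then insert (Suc n) {i \<in> {1..n}. even i} else {i \<in> {1..n}. even i})"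
    by (auto simp: le_Suc_eq)
  then show ?case using Suc by (auto simp: card_insert_if)
qed simp

lemma path_graph_balanced: "has_balanced_bipartition (path_graph n)"
proof -
  let ?X = "{i \<in> {1..n}. even i}" and ?Y = "{i \<in> {1..n}. odd i}"
  have bip: "bipartition (path_graph n) ?X ?Y"
    by (auto simp: bipartition_def path_graph_verts path_graph_adj)
  have "card ?X + card ?Y = n"
    using bipartition_card(3)[OF bip] by (simp add: path_graph_verts)
  then have "if even n then card ?X = card ?Y else \<bar>int (card ?X) - int (card ?Y)\<bar> = 1"
    unfolding card_even_upto by (auto elim!: evenE oddE)
  with bip show ?thesis
    unfolding has_balanced_bipartition_def path_graph_verts card_atLeastAtMost diff_Suc_1 by blast
qed

section \<open>Minimizers and copies of the path\<close>

lemma path_graph_in_trees: "1 \<le> n \<Longrightarrow> path_graph n \<in> trees n"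
  by (simp add: trees_def path_graph_tree path_graph_verts)

text \<open>Minimizers compete among trees over \<open>'a\<close>, but \<open>path_graph\<close>
  lives over the naturals. The path is therefore copied onto the vertex set of \<open>T\<close>,
  which guarantees enough elements of \<open>'a\<close>.\<close>

lemma trees_contain_path:
  assumes T: "T \<in> (trees n :: 'a ugraph set)" and n: "1 \<le> n"
  obtains P where "P \<in> (trees n :: 'a ugraph set)" "graph_iso P (path_graph n)"
proof -
  have "finite (verts T)" "card (verts T) = n"
    using T by (auto simp: trees_def intro: loop_graph_finite[OF tree_loop_graph])
  then obtain \<phi> where \<phi>: "bij_betw \<phi> (verts T) {1..n}"
    using finite_same_card_bij[of "verts T" "{1..n}"] by auto
  define P where "P = \<lparr>verts = verts T,
    edges = {{u, v} | u v. u \<in> verts T \<and> v \<in> verts T \<and> adj (path_graph n) (\<phi> u) (\<phi> v)}\<rparr>"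
  have adj: "adj P u v \<longleftrightarrow> u \<in> verts T \<and> v \<in> verts T \<and> adj (path_graph n) (\<phi> u) (\<phi> v)" for u v
  proof -
    have "adj P u v \<longleftrightarrow> {u, v} \<in> edges P" by (rule adj_def)
    then show ?thesis
      using adj_commute[of "path_graph n" "\<phi> u" "\<phi> v"] by (auto simp: P_def doubleton_eq_iff)
  qed
  have "card {u, v} = 1 \<or> card {u, v} = 2" for u v :: 'a
    by (cases "u = v") auto
  then have lg: "loop_graph P"
    using \<open>finite (verts T)\<close> by (auto simp: loop_graph_def P_def)
  have iso: "graph_iso P (path_graph n)"
    unfolding graph_iso_def path_graph_verts using \<phi> adj by (intro exI[of _ \<phi>]) (simp add: P_def)
  then have "tree P"
    using tree_iso[OF path_graph_tree[OF n] graph_iso_sym lg] by blast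
  then have "P \<in> trees n"
    using graph_iso_card[OF iso] by (simp add: trees_def path_graph_verts)
  with iso that show thesis by blast
qed

lemma hom_eq_if_iso_path:
  assumes "tree T" "graph_iso T (path_graph n)" "loop_graph H"
  shows "hom T H = hom (path_graph n) H"
  using hom_iso[OF assms(2) graph_iso_refl tree_loop_graph[OF assms(1)] path_graph_loop_graph assms(3,3)] .

lemma minimizers_eq_if_bound_attained:
  assumes ge: "\<And>T. T \<in> (trees n :: 'a ugraph set) \<Longrightarrow> c \<le> hom T H"
    and path: "hom (path_graph n) H = c" and H: "loop_graph H" and n: "1 \<le> n"
  shows "minimizers n H = {T \<in> (trees n :: 'a ugraph set). hom T H = c}"
proof (intro set_eqI iffI)
  fix T assume T: "T \<in> (minimizers n H :: 'a ugraph set)"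
  then have tT: "T \<in> trees n" by (simp add: minimizers_def)
  from trees_contain_path[OF tT n] obtain P where P: "P \<in> (trees n :: 'a ugraph set)" "graph_iso P (path_graph n)" .
  then have "hom P H = c"
    using hom_eq_if_iso_path[OF _ P(2) H] path by (simp add: trees_def)
  then have "hom T H \<le> c" using T P(1) unfolding minimizers_def by force
  with ge[OF tT] tT show "T \<in> {T \<in> trees n. hom T H = c}" by simp
qed (use ge in \<open>auto simp: minimizers_def\<close>)

lemma (in ranked_target) minimizers_eq_paths:
  assumes n: "2 \<le> n" and H: "loop_graph H"
  shows "minimizers n H = {T \<in> (trees n :: 'a ugraph set). graph_iso T (path_graph n)}"
proof -
  have n1: "1 \<le> n" using n by simp
  have "minimizers n H = {T \<in> (trees n :: 'a ugraph set). hom T H = hom (path_graph n) H}"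
    by (rule minimizers_eq_if_bound_attained[OF _ refl H n1]) (auto simp: trees_def hom_path_graph_le)
  also have "\<dots> = {T \<in> trees n. graph_iso T (path_graph n)}"
    using iso_path_graph_if_hom_le n hom_eq_if_iso_path[OF _ _ H] by (auto simp: trees_def)
  finally show ?thesis .
qed

subsection \<open>Classification of the graphs on at most three vertices\<close>

text \<open>The Boolean parameters record the whole adjacency relation for a chosen order of the
  vertices, which turns the classification into a finite check.\<close>

definition pattern2 :: "'b ugraph \<Rightarrow> 'b \<Rightarrow> 'b \<Rightarrow> bool \<Rightarrow> bool \<Rightarrow> bool \<Rightarrow> bool" where
  "pattern2 H a b la lb ab \<longleftrightarrow> verts H = {a, b} \<and> a \<noteq> b \<and>
     (adj H a a \<longleftrightarrow> la) \<and> (adj H b b \<longleftrightarrow> lb) \<and> (adj H a b \<longleftrightarrow> ab)"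

definition pattern3 ::
  "'b ugraph \<Rightarrow> 'b \<Rightarrow> 'b \<Rightarrow> 'b \<Rightarrow> bool \<Rightarrow> bool \<Rightarrow> bool \<Rightarrow> bool \<Rightarrow> bool \<Rightarrow> bool \<Rightarrow> bool" where
  "pattern3 H a b c la lb lc ab ac bc \<longleftrightarrow>
     verts H = {a, b, c} \<and> a \<noteq> b \<and> a \<noteq> c \<and> b \<noteq> c \<and>
     (adj H a a \<longleftrightarrow> la) \<and> (adj H b b \<longleftrightarrow> lb) \<and> (adj H c c \<longleftrightarrow> lc) \<and>
     (adj H a b \<longleftrightarrow> ab) \<and> (adj H a c \<longleftrightarrow> ac) \<and> (adj H b c \<longleftrightarrow> bc)"

lemma pattern2_iso:
  assumes "pattern2 H a b la lb ab" "pattern2 K a' b' la lb ab"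
  shows "graph_iso H K"
proof -
  let ?f = "\<lambda>x. if x = a then a' else b'"
  have "bij_betw ?f (verts H) (verts K)"
    using assms by (auto simp: pattern2_def bij_betw_def inj_on_def)
  moreover have "\<forall>u\<in>verts H. \<forall>v\<in>verts H. adj H u v \<longleftrightarrow> adj K (?f u) (?f v)"
    using assms adj_commute[of H b a] adj_commute[of K b' a'] by (auto simp: pattern2_def)
  ultimately show ?thesis unfolding graph_iso_def by blast
qed

lemma pattern3_iso:
  assumes "pattern3 H a b c la lb lc ab ac bc" "pattern3 K a' b' c' la lb lc ab ac bc"
  shows "graph_iso H K"
proof -
  let ?f = "\<lambda>x. if x = a then a' else if x = b then b' else c'"
  have "bij_betw ?f (verts H) (verts K)"
    using assms by (auto simp: pattern3_def bij_betw_def inj_on_def)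
  moreover have "\<forall>u\<in>verts H. \<forall>v\<in>verts H. adj H u v \<longleftrightarrow> adj K (?f u) (?f v)"
    using assms adj_commute[of H b a] adj_commute[of K b' a'] adj_commute[of H c a]
      adj_commute[of K c' a'] adj_commute[of H c b] adj_commute[of K c' b']
    by (auto simp: pattern3_def)
  ultimately show ?thesis unfolding graph_iso_def by blast
qed

lemma pattern2_H_graph:
    "pattern2 (H_graph 3) 1 2 False False False"
    "pattern2 (H_graph 4) 1 2 False True False"
    "pattern2 (H_graph 5) 1 2 True True False"
    "pattern2 (H_graph 6) 1 2 False False True"
    "pattern2 (H_graph 7) 1 2 False True True"
    "pattern2 (H_graph 8) 1 2 True True True"
  by (simp_all add: pattern2_def adj_H_simps)

lemma pattern3_H_graph:
    "pattern3 (H_graph 9) 1 2 3 False False False False False False"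
    "pattern3 (H_graph 10) 1 2 3 False True False False False False"
    "pattern3 (H_graph 11) 1 2 3 True False True False False False"
    "pattern3 (H_graph 12) 1 2 3 True True True False False False"
    "pattern3 (H_graph 13) 1 2 3 False False False True False False"
    "pattern3 (H_graph 14) 1 2 3 False False True True False False"
    "pattern3 (H_graph 15) 1 2 3 True False False True False False"
    "pattern3 (H_graph 16) 1 2 3 True False True True False False"
    "pattern3 (H_graph 17) 1 2 3 True True False True False False"
    "pattern3 (H_graph 18) 1 2 3 True True True True False False"
    "pattern3 (H_graph 19) 1 2 3 False False False True False True"
    "pattern3 (H_graph 20) 1 2 3 True False False True False True"
    "pattern3 (H_graph 21) 1 2 3 False True False True False True"
    "pattern3 (H_graph 22) 1 2 3 False True True True False True"
    "pattern3 (H_graph 23) 1 2 3 True False True True False True"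
    "pattern3 (H_graph 24) 1 2 3 True True True True False True"
    "pattern3 (H_graph 25) 1 2 3 False False False True True True"
    "pattern3 (H_graph 26) 1 2 3 True False False True True True"
    "pattern3 (H_graph 27) 1 2 3 True True False True True True"
    "pattern3 (H_graph 28) 1 2 3 True True True True True True"
  by (simp_all add: pattern3_def adj_H_simps)

section \<open>Completeness of the table\<close>

definition tabled2 :: "bool \<Rightarrow> bool \<Rightarrow> bool \<Rightarrow> bool" where
  "tabled2 la lb ab \<longleftrightarrow> (\<exists>i\<in>{1..28}. pattern2 (H_graph i) 1 2 la lb ab)"

definition tabled3 :: "bool \<Rightarrow> bool \<Rightarrow> bool \<Rightarrow> bool \<Rightarrow> bool \<Rightarrow> bool \<Rightarrow> bool" where
  "tabled3 la lb lc ab ac bc \<longleftrightarrow>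
     (\<exists>i\<in>{1..28}. pattern3 (H_graph i) 1 2 3 la lb lc ab ac bc)"

lemma tabled2I: "pattern2 (H_graph i) 1 2 la lb ab \<Longrightarrow> i \<in> {1..28} \<Longrightarrow> tabled2 la lb ab"
  unfolding tabled2_def by blast

lemma tabled3I:
  "pattern3 (H_graph i) 1 2 3 la lb lc ab ac bc \<Longrightarrow> i \<in> {1..28} \<Longrightarrow> tabled3 la lb lc ab ac bc"
  unfolding tabled3_def by blast

lemmas tabled2_rows = pattern2_H_graph[THEN tabled2I, simplified]
lemmas tabled3_rows = pattern3_H_graph[THEN tabled3I, simplified]

lemma tabled2_complete: "tabled2 la lb ab \<or> tabled2 lb la ab"
  by (cases la; cases lb; cases ab; simp add: tabled2_rows)

text \<open>The six disjuncts are the six orders of the three vertices; all 64 Boolean patterns are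
  checked.\<close>

lemma tabled3_complete:
  "tabled3 la lb lc ab ac bc \<or> tabled3 lb la lc ab bc ac \<or> tabled3 lc lb la bc ac ab \<or>
   tabled3 la lc lb ac ab bc \<or> tabled3 lb lc la bc ab ac \<or> tabled3 lc la lb ac bc ab"
  by (cases la; cases lb; cases lc; cases ab; cases ac; cases bc; simp add: tabled3_rows)

lemma H_graph_complete2:
  assumes "card (verts H) = 2"
  shows "\<exists>i\<in>{1..28}. graph_iso H (H_graph i)"
proof -
  have iso: "\<exists>i\<in>{1..28}. graph_iso H (H_graph i)"
    if "tabled2 la lb ab" "pattern2 H a b la lb ab" for a b la lb ab
    using that unfolding tabled2_def by (meson pattern2_iso)
  obtain a b where V: "verts H = {a, b}" "a \<noteq> b" using assms by (auto simp: card_2_iff)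
  have p: "pattern2 H x y (adj H x x) (adj H y y) (adj H x y)" if "verts H = {x, y}" "x \<noteq> y" for x y
    using that by (simp add: pattern2_def)
  show ?thesis
    using tabled2_complete[of "adj H a a" "adj H b b" "adj H a b"]
      iso[OF _ p, of a b] iso[OF _ p, of b a] V adj_commute[of H b a] by (auto simp: insert_commute)
qed

lemma H_graph_complete3:
  assumes "card (verts H) = 3"
  shows "\<exists>i\<in>{1..28}. graph_iso H (H_graph i)"
proof -
  obtain a b c where V: "verts H = {a, b, c}" "a \<noteq> b" "a \<noteq> c" "b \<noteq> c"
    using assms by (auto simp: card_3_iff)
  have iso: "\<exists>i\<in>{1..28}. graph_iso H (H_graph i)"
    if "tabled3 (adj H x x) (adj H y y) (adj H z z) (adj H x y) (adj H x z) (adj H y z)"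
      "verts H = {x, y, z}" "x \<noteq> y" "x \<noteq> z" "y \<noteq> z" for x y z
  proof -
    have "pattern3 H x y z (adj H x x) (adj H y y) (adj H z z) (adj H x y) (adj H x z) (adj H y z)"
      using that by (simp add: pattern3_def)
    then show ?thesis using that(1) unfolding tabled3_def by (meson pattern3_iso)
  qed
  have perm: "{a, b, c} = {b, a, c}" "{a, b, c} = {c, b, a}" "{a, b, c} = {a, c, b}"
    "{a, b, c} = {b, c, a}" "{a, b, c} = {c, a, b}" by auto
  \<comment> \<open>Adjacencies are normalised so that the premise for each vertex order matches its
    disjunct in \<open>tabled3_complete\<close> literally.\<close>
  have sym: "adj H b a = adj H a b" "adj H c a = adj H a c" "adj H c b = adj H b c"
    by (rule adj_commute)+
  note neq = V(2-4) V(2-4)[symmetric]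
  note cases = iso[of a b c, unfolded sym, OF _ V(1)] iso[of b a c, unfolded sym, OF _ trans[OF V(1) perm(1)]]
    iso[of c b a, unfolded sym, OF _ trans[OF V(1) perm(2)]] iso[of a c b, unfolded sym, OF _ trans[OF V(1) perm(3)]]
    iso[of b c a, unfolded sym, OF _ trans[OF V(1) perm(4)]] iso[of c a b, unfolded sym, OF _ trans[OF V(1) perm(5)]]
  show ?thesis
    using tabled3_complete[of "adj H a a" "adj H b b" "adj H c c" "adj H a b" "adj H a c" "adj H b c"]
    by (elim disjE) (rule cases; (assumption | rule neq))+
qed

lemma H_graph_complete1:
  assumes "card (verts H) = 1"
  shows "\<exists>i\<in>{1..28}. graph_iso H (H_graph i)"
proof -
  obtain a where a: "verts H = {a}" using assms by (auto simp: card_1_singleton_iff)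
  have "graph_iso H (H_graph (if adj H a a then 2 else 1))"
    unfolding graph_iso_def using a
    by (intro exI[of _ "\<lambda>_. 1"]) (simp add: bij_betw_def adj_H_simps)
  then show ?thesis by (rule bexI) auto
qed

text \<open>
  On at most three vertices the isomorphism type is determined by the numbers of vertices, of
  edges, of loops and of incidences between a looped vertex and a non-loop edge.
\<close>

definition graph_invariants :: "'b ugraph \<Rightarrow> nat \<times> nat \<times> nat \<times> nat" where
  "graph_invariants G = (card (verts G),
     \<Sum>u\<in>verts G. \<Sum>v\<in>verts G. of_bool (u \<noteq> v \<and> adj G u v),
     \<Sum>u\<in>verts G. of_bool (adj G u u),
     \<Sum>u\<in>verts G. \<Sum>v\<in>verts G. of_bool (u \<noteq> v \<and> adj G u v \<and> adj G u u))"

lemma graph_invariants_iso: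
  assumes "graph_iso G H"
  shows "graph_invariants G = graph_invariants H"
proof -
  from assms obtain \<phi> where \<phi>: "bij_betw \<phi> (verts G) (verts H)"
    and adj: "\<And>u v. u \<in> verts G \<Longrightarrow> v \<in> verts G \<Longrightarrow> adj G u v \<longleftrightarrow> adj H (\<phi> u) (\<phi> v)"
    unfolding graph_iso_def by blast
  have eq: "\<phi> u = \<phi> v \<longleftrightarrow> u = v" if "u \<in> verts G" "v \<in> verts G" for u v
    using \<phi> that by (auto simp: bij_betw_def dest: inj_onD)
  show ?thesis
    unfolding graph_invariants_def sum.reindex_bij_betw[OF \<phi>, symmetric]
    using bij_betw_same_card[OF \<phi>] by (simp add: adj eq cong: sum.cong)
qed

text \<open>The second entry counts ordered pairs, hence each non-loop edge twice. The 28 tuples are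
  pairwise distinct, which separates the isomorphism types.\<close>

lemma graph_invariants_H_graph:
  "map (\<lambda>i. graph_invariants (H_graph i)) [1..<29] =
     [
       (1,0,0,0), (1,0,1,0), (2,0,0,0), (2,0,1,0), (2,0,2,0), (2,2,0,0), (2,2,1,1),
       (2,2,2,2), (3,0,0,0), (3,0,1,0), (3,0,2,0), (3,0,3,0), (3,2,0,0), (3,2,1,0),
       (3,2,1,1), (3,2,2,1), (3,2,2,2), (3,2,3,2), (3,4,0,0), (3,4,1,1), (3,4,1,2),
       (3,4,2,3), (3,4,2,2), (3,4,3,4), (3,6,0,0), (3,6,1,2), (3,6,2,4), (3,6,3,6)]"
  by (simp add: graph_invariants_def adj_H_simps upt_rec)

lemma H_graph_iso_eq:
  assumes "i \<in> {1..28}" "j \<in> {1..28}" "graph_iso (H_graph i) (H_graph j)"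
  shows "i = j"
proof -
  let ?L = "map (\<lambda>i. graph_invariants (H_graph i)) [1..<29]"
  have "?L ! (k - 1) = graph_invariants (H_graph k)" if "k \<in> {1..28}" for k
    using that by (subst nth_map_upt) auto
  then have "?L ! (i - 1) = ?L ! (j - 1)"
    using assms graph_invariants_iso[OF assms(3)] by simp
  moreover have "distinct ?L" unfolding graph_invariants_H_graph by simp
  moreover have "i - 1 < length ?L" "j - 1 < length ?L" using assms by auto
  ultimately have "i - 1 = j - 1" using nth_eq_iff_index_eq by blast
  then show ?thesis using assms by auto
qed

lemma H_graph_indices:
  "{1..28::nat} = {1, 2, 3, 4, 5, 6, 7, 8, 9, 10, 11, 12, 13, 14,
    15, 16, 17, 18, 19, 20, 21, 22, 23, 24, 25, 26, 27, 28}"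
  unfolding atLeastAtMost_upt by (simp add: upt_conv_Cons[of "Suc 0"] numeral_2_eq_2[symmetric] del: set_upt)

lemma H_graph_loop_graph:
  "\<forall>i\<in>{1..28}. loop_graph (H_graph i) \<and> card (verts (H_graph i)) \<in> {1, 2, 3}"
  unfolding H_graph_indices by (simp add: loop_graph_def H_graph_simps)

subsection \<open>Minimizers\<close>

lemma H_graph_constant:
  assumes T: "T \<in> trees n" and n: "2 \<le> n"
  shows "i \<in> {1, 3, 9} \<Longrightarrow> hom T (H_graph i) = 0"
    and "i \<in> {2, 4, 10} \<Longrightarrow> hom T (H_graph i) = 1"
    and "i \<in> {5, 6, 11, 13} \<Longrightarrow> hom T (H_graph i) = 2"
    and "i \<in> {12, 14} \<Longrightarrow> hom T (H_graph i) = 3"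
    and "i \<in> {8, 17} \<Longrightarrow> hom T (H_graph i) = 2 ^ n"
    and "hom T (H_graph 18) = 2 ^ n + 1"
    and "i \<in> {23, 25} \<Longrightarrow> hom T (H_graph i) = 3 * 2 ^ (n - 1)"
    and "hom T (H_graph 28) = 3 ^ n"
proof -
  obtain m where "n = 2 + m" using n le_Suc_ex by blast
  then have m: "n = Suc (Suc m)" by simp
  have tree: "tree T" and card: "card (verts T) = n" using T by (simp_all add: trees_def)
  \<comment> \<open>In each of these targets, adjacent vertices have equal degree. The exponent
    \<open>n - 1 = Suc m\<close> is positive, so isolated vertices contribute 0.\<close>
  have *: "hom T (H_graph i) = (\<Sum>v\<in>verts (H_graph i). nsum (H_graph i) (\<lambda>_. 1) v ^ Suc m)"
    if "i \<in> {1, 3, 9, 2, 4, 10, 5, 6, 11, 13, 12, 14, 8, 17, 18, 23, 25, 28}" for i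
  proof -
    have fin: "finite (verts (H_graph i))" by (simp add: H_graph_def)
    have "\<forall>u\<in>verts (H_graph i). \<forall>v\<in>verts (H_graph i). adj (H_graph i) u v \<longrightarrow>
        nsum (H_graph i) (\<lambda>_. 1) u = nsum (H_graph i) (\<lambda>_. 1) v"
      using that by (elim insertE emptyE; hypsubst; simp add: nsum_def adj_H_simps)
    then show ?thesis using hom_locally_regular[OF tree fin] card m by simp
  qed
  note simps = nsum_def adj_H_simps m numeral_2_eq_2[symmetric] numeral_3_eq_3[symmetric]
  show "i \<in> {1, 3, 9} \<Longrightarrow> hom T (H_graph i) = 0"
    by (elim insertE emptyE; hypsubst; rule trans[OF *]; simp add: simps)
  show "i \<in> {2, 4, 10} \<Longrightarrow> hom T (H_graph i) = 1"
    by (elim insertE emptyE; hypsubst; rule trans[OF *]; simp add: simps)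
  show "i \<in> {5, 6, 11, 13} \<Longrightarrow> hom T (H_graph i) = 2"
    by (elim insertE emptyE; hypsubst; rule trans[OF *]; simp add: simps)
  show "i \<in> {12, 14} \<Longrightarrow> hom T (H_graph i) = 3"
    by (elim insertE emptyE; hypsubst; rule trans[OF *]; simp add: simps)
  show "i \<in> {8, 17} \<Longrightarrow> hom T (H_graph i) = 2 ^ n"
    by (elim insertE emptyE; hypsubst; rule trans[OF *]; simp add: simps)
  show "hom T (H_graph 18) = 2 ^ n + 1" by (rule trans[OF *]; simp add: simps)
  show "i \<in> {23, 25} \<Longrightarrow> hom T (H_graph i) = 3 * 2 ^ (n - 1)"
    by (elim insertE emptyE; hypsubst; rule trans[OF *]; simp add: simps)
  show "hom T (H_graph 28) = 3 ^ n" by (rule trans[OF *]; simp add: simps)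
qed

lemma all_minimizeI:
  assumes "\<And>T. T \<in> (trees n :: 'a ugraph set) \<Longrightarrow> hom T H = c"
  shows "all_minimize TYPE('a) n H c"
  using assms by (auto simp: all_minimize_def minimizers_def)

lemma H_graph_ranked:
  assumes "i \<in> {7, 15, 16, 20, 21, 22, 24, 26, 27}"
  shows "\<exists>rank l U. ranked_target (H_graph i) rank l U"
proof -
  note simps = ranked_target_def monotone_vec_def nsum_def adj_H_simps
  \<comment> \<open>Except for \<open>H_graph 20\<close>, the set \<open>U\<close> consists of one
    looped neighbour of \<open>l\<close>.\<close>
  have "ranked_target (H_graph 7) (\<lambda>i. i) 1 {2}" by (simp add: simps)
  \<comment> \<open>Here and for \<open>H_graph 16\<close>, \<open>l\<close> is not the vertex of
    lowest rank: vertex 3 is a component of its own, so no walk leads from it to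
    \<open>U\<close>.\<close>
  moreover have "ranked_target (H_graph 15) (\<lambda>i. 3 - i) 2 {1}" by (simp add: simps)
  moreover have "ranked_target (H_graph 16) (\<lambda>i. 3 - i) 2 {1}" by (simp add: simps)
  \<comment> \<open>The only neighbour of \<open>l = 3\<close> is the loopless vertex 2, so
    \<open>U\<close> also contains the looped vertex 1.\<close>
  moreover have "ranked_target (H_graph 20) (\<lambda>i. 3 - i) 3 {1, 2}" by (auto simp: simps)
  \<comment> \<open>Tied ranks force equal entries; here, and in the last three targets, the tied
    vertices are exchanged by an automorphism.\<close>
  moreover have "ranked_target (H_graph 21) (\<lambda>i. of_bool (i = 2)) 1 {2}" by (simp add: simps)
  \<comment> \<open>The order is 1, 3, 2, along which the neighbourhoods \<open>{2}\<close>,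
    \<open>{2, 3}\<close>, \<open>{1, 2, 3}\<close> increase.\<close>
  moreover have "ranked_target (H_graph 22) (\<lambda>i. if i = 2 then 4 else i) 1 {2}" by (simp add: simps)
  moreover have "ranked_target (H_graph 24) (\<lambda>i. of_bool (i = 2)) 1 {2}" by (simp add: simps)
  moreover have "ranked_target (H_graph 26) (\<lambda>i. of_bool (i = 1)) 2 {1}" by (simp add: simps)
  moreover have "ranked_target (H_graph 27) (\<lambda>i. of_bool (i \<noteq> 3)) 3 {1}" by (simp add: simps)
  ultimately show ?thesis using assms by (elim insertE emptyE) blast+
qed

lemma hom_path_graph_le_H_graph:
  assumes i: "i \<in> {1..28}" and n: "2 \<le> n" and T: "T \<in> trees n"
  shows "hom (path_graph n) (H_graph i) \<le> hom T (H_graph i)"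
proof -
  have tree: "tree T" "card (verts T) = n" using T by (simp_all add: trees_def)
  have P: "path_graph n \<in> trees n" using n by (simp add: path_graph_in_trees)
  note const = H_graph_constant[OF P n] H_graph_constant[OF T n]
  consider "i \<in> {1, 3, 9}" | "i \<in> {2, 4, 10}" | "i \<in> {5, 6, 11, 13}" | "i \<in> {12, 14}"
    | "i \<in> {8, 17}" | "i = 18" | "i \<in> {23, 25}" | "i = 28" | "i = 19"
    | "i \<in> {7, 15, 16, 20, 21, 22, 24, 26, 27}"
    using i unfolding H_graph_indices by blast
  then show ?thesis
  proof cases
    case 9
    have "hom (path_graph n) (H_graph 19) = 2 ^ (n div 2) + 2 ^ (n - n div 2)"
      using hom_H19_balanced(2)[of "path_graph n" n] path_graph_balanced n
      by (simp add: path_graph_tree path_graph_verts)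
    then show ?thesis using hom_H19_balanced(1)[OF tree] 9 by simp
  next
    case 10
    then obtain rank l U where "ranked_target (H_graph i) rank l U" using H_graph_ranked by blast
    from ranked_target.hom_path_graph_le[OF this tree(1)] tree(2) show ?thesis by simp
  qed (simp_all add: const)
qed

theorem mainTheorem16:
  shows
    "(\<forall>i\<in>{1..28}. loop_graph (H_graph i) \<and> card (verts (H_graph i)) \<in> {1,2,3}) \<and>
     (\<forall>i\<in>{1..28}. \<forall>j\<in>{1..28}. graph_iso (H_graph i) (H_graph j) \<longrightarrow> i = j) \<and>
     (\<forall>H :: 'h ugraph. loop_graph H \<and> card (verts H) \<in> {1,2,3} \<longrightarrow>
        (\<exists>i\<in>{1..28}. graph_iso H (H_graph i))) \<and>
     (\<forall>n\<ge>2.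
        path_graph n \<in> trees n \<and>
        (\<forall>H :: 'h ugraph. loop_graph H \<and> card (verts H) \<in> {1,2,3} \<longrightarrow>
           (\<forall>T \<in> (trees n :: 'a ugraph set). hom (path_graph n) H \<le> hom T H)) \<and>
        (\<forall>i\<in>{1..28}. \<forall>T \<in> (trees n :: 'a ugraph set).
           hom (path_graph n) (H_graph i) \<le> hom T (H_graph i)) \<and>
        (\<forall>i\<in>{1,3,9}. all_minimize TYPE('a) n (H_graph i) 0) \<and>
        (\<forall>i\<in>{2,4,10}. all_minimize TYPE('a) n (H_graph i) 1) \<and>
        (\<forall>i\<in>{5,6,11,13}. all_minimize TYPE('a) n (H_graph i) 2) \<and>
        (\<forall>i\<in>{12,14}. all_minimize TYPE('a) n (H_graph i) 3) \<and>
        (\<forall>i\<in>{8,17}. all_minimize TYPE('a) n (H_graph i) (2 ^ n)) \<and>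
        all_minimize TYPE('a) n (H_graph 18) (2 ^ n + 1) \<and>
        (\<forall>i\<in>{23,25}. all_minimize TYPE('a) n (H_graph i) (3 * 2 ^ (n - 1))) \<and>
        all_minimize TYPE('a) n (H_graph 28) (3 ^ n) \<and>
        minimizers n (H_graph 19) = {T \<in> (trees n :: 'a ugraph set). has_balanced_bipartition T} \<and>
        (\<forall>i\<in>{7,15,16,20,21,22,24,26,27}.
           minimizers n (H_graph i) = {T \<in> (trees n :: 'a ugraph set). graph_iso T (path_graph n)}))"
proof (intro conjI allI impI)
  show "\<forall>i\<in>{1..28}. loop_graph (H_graph i) \<and> card (verts (H_graph i)) \<in> {1, 2, 3}"
    by (rule H_graph_loop_graph)
  show "\<forall>i\<in>{1..28}. \<forall>j\<in>{1..28}. graph_iso (H_graph i) (H_graph j) \<longrightarrow> i = j"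
    using H_graph_iso_eq by blast
  show complete: "\<exists>i\<in>{1..28}. graph_iso H (H_graph i)"
    if "loop_graph H \<and> card (verts H) \<in> {1, 2, 3}" for H :: "'h ugraph"
    using that H_graph_complete1 H_graph_complete2 H_graph_complete3 by auto
  fix n :: nat assume n: "2 \<le> n"
  then have n1: "1 \<le> n" by simp
  have lg: "loop_graph (H_graph i)" if "i \<in> {1..28}" for i
    using H_graph_loop_graph that by blast
  show P: "path_graph n \<in> trees n" using n1 by (rule path_graph_in_trees)
  note le = hom_path_graph_le_H_graph[OF _ n]
  show "\<forall>T \<in> (trees n :: 'a ugraph set). hom (path_graph n) H \<le> hom T H"
    if H: "loop_graph H \<and> card (verts H) \<in> {1, 2, 3}" for H :: "'h ugraph"
  proof
    fix T :: "'a ugraph" assume T: "T \<in> trees n"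
    obtain i where i: "i \<in> {1..28}" and iso: "graph_iso H (H_graph i)"
      using complete[OF H] by blast
    \<comment> \<open>Polymorphic in the vertices of \<open>G\<close>, since it is used for the path
      over the naturals and for \<open>T\<close> over \<open>'a\<close>.\<close>
    have eq: "hom G H = hom G (H_graph i)" if "loop_graph G" for G :: "'c ugraph"
      using hom_iso[OF graph_iso_refl iso that that] H lg[OF i] by blast
    show "hom (path_graph n) H \<le> hom T H"
      using le[OF i T] eq[OF path_graph_loop_graph] T by (simp add: trees_def tree_loop_graph eq)
  qed
  show "\<forall>i\<in>{1..28}. \<forall>T \<in> (trees n :: 'a ugraph set).
      hom (path_graph n) (H_graph i) \<le> hom T (H_graph i)"
    using le by blast
  note const = H_graph_constant[OF _ n]
  show "\<forall>i\<in>{1,3,9}. all_minimize TYPE('a) n (H_graph i) 0"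
    "\<forall>i\<in>{2,4,10}. all_minimize TYPE('a) n (H_graph i) 1"
    "\<forall>i\<in>{5,6,11,13}. all_minimize TYPE('a) n (H_graph i) 2"
    "\<forall>i\<in>{12,14}. all_minimize TYPE('a) n (H_graph i) 3"
    "\<forall>i\<in>{8,17}. all_minimize TYPE('a) n (H_graph i) (2 ^ n)"
    "all_minimize TYPE('a) n (H_graph 18) (2 ^ n + 1)"
    "\<forall>i\<in>{23,25}. all_minimize TYPE('a) n (H_graph i) (3 * 2 ^ (n - 1))"
    "all_minimize TYPE('a) n (H_graph 28) (3 ^ n)"
    by (intro ballI all_minimizeI const; assumption)+
  show "minimizers n (H_graph 19) = {T \<in> (trees n :: 'a ugraph set). has_balanced_bipartition T}"
  proof -
    let ?c = "2 ^ (n div 2) + 2 ^ (n - n div 2)"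
    have "minimizers n (H_graph 19) = {T \<in> (trees n :: 'a ugraph set). hom T (H_graph 19) = ?c}"
    proof (rule minimizers_eq_if_bound_attained[OF _ _ lg n1])
      show "hom (path_graph n) (H_graph 19) = ?c"
        using hom_H19_balanced(2)[of "path_graph n" n] path_graph_balanced n1
        by (simp add: path_graph_tree path_graph_verts)
    qed (auto simp: trees_def hom_H19_balanced(1))
    also have "\<dots> = {T \<in> trees n. has_balanced_bipartition T}"
      by (auto simp: trees_def hom_H19_balanced(2))
    finally show ?thesis .
  qed
  show "\<forall>i\<in>{7,15,16,20,21,22,24,26,27}.
      minimizers n (H_graph i) = {T \<in> (trees n :: 'a ugraph set). graph_iso T (path_graph n)}"
  proof
    fix i :: nat assume i: "i \<in> {7,15,16,20,21,22,24,26,27}"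
    then obtain rank l U where R: "ranked_target (H_graph i) rank l U" using H_graph_ranked by blast
    have "i \<in> {1..28}" using i by auto
    from ranked_target.minimizers_eq_paths[OF R n lg[OF this]]
    show "minimizers n (H_graph i) = {T \<in> (trees n :: 'a ugraph set). graph_iso T (path_graph n)}" .
  qed
qed

end
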